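(* For any dimension $d\ge 2$ and every $L>3$, $$\lambda_{c,r}(L)\ \ge\ \frac{\Gamma((d+1)/2)}{2^d\,\pi^{d/2}}\,L^{-1}.$$ Furthermore, for any $d\ge 2$ and every $L>10$, $$\lambda_{c,r}(L)\ \le\ 4\,\frac{2^d\,\Gamma((d+1)/2)}{\pi^{d/2-1}}\,L^{-1}.$$
   Context: Poisson stick model in $\mathbb{R}^d$, $d\ge 2$. Let $\mathbb{S}=\{p\in\mathbb{R}^d:\Vert p\Vert=1\}$ (Euclidean norm). For $(x,p)\in\mathbb{R}^d\times\mathbb{S}$ and $L>0$ let $\ell_{x,p,L}=\{x+tp:-L/2\le t\le L/2\}$ and let the stick be $S_{x,p,L}=\{y\in\mathbb{R}^d:\mathrm{dist}(y,\ell_{x,p,L})\le 1\}$. For a probability measure $\Theta$ on $\mathbb{S}$ (the orientation distribution) and $\lambda>0$ let $\Pi^\lambda$ be a Poisson point process on $\mathbb{R}^d\times\mathbb{S}$ with intensity measure $\mu_\lambda=\lambda\,\mathrm{Leb}\otimes\Theta$, where $\mathrm{Leb}$ is Lebesgue measure on $\mathbb{R}^d$. Let $\mathcal{C}(\Pi^\lambda)=\bigcup_{(x,p)\in\Pi^\lambda}S_{x,p,L}$. One says $\mathcal{C}(\Pi^\lambda)$ percolates if it contains an unbounded connected component; this event has probability $0$ or $1$. Define $\lambda_{c,\Theta}(L)=\inf\{\lambda>0:\mathbb{P}(\mathcal{C}(\Pi^\lambda)\text{ percolates})=1\}$. Rigid case: $\lambda_{c,r}(L)$ denotes $\lambda_{c,\Theta}(L)$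 when $\Theta=\delta_{e_2}$, the point mass at the second standard unit vector $e_2$. $\Gamma$ is the gamma function. *)

theory Defs
  imports "HOL-Probability.Probability"
begin

text \<open>Number of points of \<open>Y\<close> lying in \<open>A\<close>; it is \<open>\<infinity>\<close> (not 0, as with \<open>card\<close>) when there are
  infinitely many.\<close>
definition num_points :: "'a set \<Rightarrow> 'a set \<Rightarrow> ennreal" where
  "num_points Y A = emeasure (count_space UNIV) (Y \<inter> A)"

text \<open>A point process is a random set of points. This loses nothing here, since the intensity
  measures below have no atoms, so that the points are almost surely distinct; local finiteness
  likewise holds almost surely, because bounded sets have finite intensity.\<close>
definition poisson_point_process :: "'w measure \<Rightarrow> 'a measure \<Rightarrow> ('w \<Rightarrow> 'a set) \<Rightarrow> bool" where
  "poisson_point_process M \<mu> X \<longleftrightarrow>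
     prob_space M \<and>
     (\<forall>\<omega>\<in>space M. X \<omega> \<subseteq> space \<mu>) \<and>
     (\<forall>A\<in>sets \<mu>. (\<lambda>\<omega>. num_points (X \<omega>) A) \<in> borel_measurable M) \<and>
     (\<forall>A\<in>sets \<mu>. emeasure \<mu> A < \<infinity> \<longrightarrow>
        (\<forall>k::nat. measure M {\<omega>\<in>space M. num_points (X \<omega>) A = of_nat k} =
           measure \<mu> A ^ k / fact k * exp (- measure \<mu> A))) \<and>
     (\<forall>(n::nat) A. (\<forall>i<n. A i \<in> sets \<mu>) \<longrightarrow> disjoint_family_on A {..<n} \<longrightarrow>
        prob_space.indep_vars M (\<lambda>_. borel) (\<lambda>i \<omega>. num_points (X \<omega>) (A i)) {..<n})"

definition stick :: "real \<Rightarrow> 'v::euclidean_space \<times> 'v \<Rightarrow> 'v set" where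
  "stick L = (\<lambda>(x, p). {y. infdist y {x + t *\<^sub>R p | t. - L / 2 \<le> t \<and> t \<le> L / 2} \<le> 1})"

definition stick_union :: "real \<Rightarrow> ('v::euclidean_space \<times> 'v) set \<Rightarrow> 'v set" where
  "stick_union L Y = (\<Union>q\<in>Y. stick L q)"

definition percolates :: "'v::euclidean_space set \<Rightarrow> bool" where
  "percolates C \<longleftrightarrow> (\<exists>K\<in>components C. \<not> bounded K)"

text \<open>Here \<open>\<Theta>\<close> is a probability measure on the subspace \<open>sphere 0 1\<close>, that is,
  \<open>sets \<Theta> = sets (restrict_space borel (sphere 0 1))\<close>.\<close>
definition stick_intensity :: "'v::euclidean_space measure \<Rightarrow> real \<Rightarrow> ('v \<times> 'v) measure" where
  "stick_intensity \<Theta> lam = scale_measure (ennreal lam) (lborel \<Otimes>\<^sub>M \<Theta>)"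

text \<open>For each \<open>lam > 0\<close>, a Poisson process \<open>X lam\<close> on a probability space \<open>M lam\<close>; the processes for
  different \<open>lam\<close> need not be coupled.\<close>
definition poisson_stick_model ::
    "'v::euclidean_space measure \<Rightarrow> (real \<Rightarrow> 'w measure) \<Rightarrow> (real \<Rightarrow> 'w \<Rightarrow> ('v \<times> 'v) set) \<Rightarrow> bool" where
  "poisson_stick_model \<Theta> M X \<longleftrightarrow>
     prob_space \<Theta> \<and> sets \<Theta> = sets (restrict_space borel (sphere 0 1)) \<and>
     (\<forall>lam>0. poisson_point_process (M lam) (stick_intensity \<Theta> lam) (X lam))"

text \<open>For a Poisson stick model with orientation distribution \<open>\<Theta>\<close> this depends only on \<open>\<Theta>\<close> and \<open>L\<close>:
  the law of a Poisson process is determined by its intensity measure. The value is extended real,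
  so that the infimum of the empty set is \<open>\<infinity>\<close>.\<close>
definition critical_intensity ::
    "(real \<Rightarrow> 'w measure) \<Rightarrow> (real \<Rightarrow> 'w \<Rightarrow> ('v::euclidean_space \<times> 'v) set) \<Rightarrow> real \<Rightarrow> ereal" where
  "critical_intensity M X L =
     Inf {ereal lam | lam. lam > 0 \<and> (AE \<omega> in M lam. percolates (stick_union L (X lam \<omega>)))}"

definition rigid_orientation :: "'v::euclidean_space \<Rightarrow> 'v measure" where
  "rigid_orientation e = return (restrict_space borel (sphere 0 1)) e"

end

theory Submission
  imports Defs
begin

text \<open>
  Both bounds are proved by comparing the stick process with a discrete structure. All sticks are
  parallel to \<open>e\<close>, so two of them meet only if the difference of their centres lies in the cylinder
  about the axis \<open>e\<close> of half-length \<open>L + 2\<close> and radius 2, and they do meet if it lies in the one of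
  half-length \<open>L\<close> and radius 2.

  Lower bound: for \<open>lam\<close> below it, the longer cylinder has volume less than \<open>1 / lam\<close>. Cut space into small
  cubes and join two cubes if they can contain the centres of two sticks that nearly meet. The number
  of neighbours of a cube times the probability that a cube is occupied is still less than 1, so almost
  surely no occupied cube starts arbitrarily long self-avoiding occupied walks. Hence every cluster of
  cubes is finite, and the clusters are at positive distance from each other.

  Upper bound: in the half-plane spanned by \<open>e\<close> and a perpendicular direction \<open>f\<close> take a
  two-dimensional grid of disjoint cylindrical cells such that the sticks of neighbouring cells
  meet. Call a block of 3 by 3 blocks good if at most one of them is bad, starting from the
  occupied cells. Good blocks are connected and neighbouring good blocks meet. A bad block of level \<open>n\<close>
  contains \<open>2 ^ n\<close> vacant cells, chosen among at most \<open>81 ^ (2 ^ n - 1)\<close> sets, and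
  a cell is vacant with probability less than \<open>exp (- 7) < 1 / 162\<close>. By the Borel-Cantelli lemma the
  blocks at the origin are good from some level on, and their union is connected and unbounded.
\<close>

section \<open>Volumes of cylinders\<close>

definition perp :: "'v::euclidean_space \<Rightarrow> 'v \<Rightarrow> 'v" where
  "perp e z = z - (z \<bullet> e) *\<^sub>R e"

lemma perp_add: "perp e (x + y) = perp e x + perp e y"
  and perp_diff: "perp e (x - y) = perp e x - perp e y"
  by (simp_all add: perp_def algebra_simps)

lemma perp_scaleR_axis: "norm e = 1 \<Longrightarrow> perp e (t *\<^sub>R e) = 0"
  by (simp add: perp_def dot_square_norm)

lemma perp_orthogonal: "q \<bullet> e = 0 \<Longrightarrow> perp e q = q"
  by (simp add: perp_def)

lemma norm_perp_le:
  assumes "norm e = 1" shows "norm (perp e z) \<le> norm z"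
proof -
  have "(norm z)\<^sup>2 = (z \<bullet> e)\<^sup>2 + (norm (perp e z))\<^sup>2"
    using assms unfolding perp_def power2_norm_eq_inner norm_eq_1
    by (simp add: inner_diff_left inner_diff_right inner_commute power2_eq_square)
  then show ?thesis
    by (metis le_add_same_cancel2 norm_ge_zero power2_le_imp_le zero_le_power2)
qed

lemma borel_measurable_perp [measurable]:
  assumes [measurable]: "f \<in> borel_measurable M"
  shows "(\<lambda>x. perp e (f x)) \<in> borel_measurable M"
  unfolding perp_def by measurable

text \<open>\<open>I\<close> is an arbitrary set because half-open intervals (for disjoint cells)
  and closed ones (for coverings) both occur. For a unit vector \<open>e\<close> and
  \<open>q\<close> orthogonal to it, this is the product of \<open>I\<close> along \<open>e\<close>
  with a ball about \<open>q\<close>.\<close>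

definition cylinder :: "'v::euclidean_space \<Rightarrow> real set \<Rightarrow> 'v \<Rightarrow> real \<Rightarrow> 'v set" where
  "cylinder e I q r = {z. z \<bullet> e \<in> I \<and> norm (perp e z - q) \<le> r}"

lemma cylinder_borel [measurable]:
  assumes [measurable]: "I \<in> sets borel"
  shows "cylinder e I q r \<in> sets borel"
  unfolding cylinder_def by measurable

text \<open>In coordinates \<open>perp e\<close> just drops the \<open>e\<close> coordinate; this
  lets the integral over a cylinder factor.\<close>

lemma norm_perp_basis_sum:
  fixes e :: "'v::euclidean_space"
  assumes e: "e \<in> Basis"
  shows "norm (perp e (\<Sum>b\<in>Basis. f b *\<^sub>R b)) = sqrt (\<Sum>b\<in>Basis - {e}. (f b)\<^sup>2)"
proof -
  let ?s = "\<Sum>b\<in>Basis. f b *\<^sub>R b"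
  have "perp e ?s = (\<Sum>b\<in>Basis - {e}. f b *\<^sub>R b)"
    unfolding perp_def using e by (subst (1) sum.remove[OF _ e]) (auto simp: inner_sum_left_Basis)
  also have "\<dots> = (\<Sum>b\<in>Basis. (if b = e then 0 else f b) *\<^sub>R b)"
    by (rule sum.mono_neutral_cong_left) auto
  finally have "norm (perp e ?s) = L2_set (\<lambda>b. if b = e then 0 else f b) Basis"
    by (subst norm_conv_dist, subst euclidean_dist_l2)
       (simp add: inner_sum_left_Basis L2_set_def)
  also have "\<dots> = sqrt (\<Sum>b\<in>Basis - {e}. (f b)\<^sup>2)"
    unfolding L2_set_def by (rule arg_cong[where f = sqrt], rule sum.mono_neutral_cong_right) auto
  finally show ?thesis .
qed

text \<open>Fubini: \<open>lborel\<close> is the image of a product of one-dimensional measures, and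
  splitting off the \<open>e\<close> coordinate leaves a ball in the other
  \<open>DIM('v) - 1\<close> coordinates. The splitting relies on \<open>e\<close> being a basis
  vector.\<close>

lemma emeasure_cylinder_0:
  fixes e :: "'v::euclidean_space"
  assumes e: "e \<in> Basis" and I[measurable]: "I \<in> sets borel" and r: "r > 0"
  shows "emeasure lborel (cylinder e I 0 r) =
           emeasure lborel I * ennreal (unit_ball_vol (real (DIM('v) - 1)) * r ^ (DIM('v) - 1))"
proof -
  interpret product_sigma_finite "\<lambda>_::'v. lborel :: real measure"
    by standard
  let ?B = "Basis - {e}" and ?P = "\<lambda>B::'v set. Pi\<^sub>M B (\<lambda>_. lborel :: real measure)"
  have ins: "insert e ?B = Basis" using e by auto
  let ?S = "{f. f e \<in> I \<and> sqrt (\<Sum>b\<in>?B. (f b)\<^sup>2) \<le> r} \<inter> space (?P Basis)"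
  let ?D = "{f. sqrt (\<Sum>b\<in>?B. (f b)\<^sup>2) \<le> r} \<inter> space (?P ?B)"
  have eq: "?S = {f \<in> space (?P Basis). f e \<in> I \<and> sqrt (\<Sum>b\<in>?B. (f b)\<^sup>2) \<le> r}" by auto
  have S[measurable]: "?S \<in> sets (?P Basis)"
    unfolding eq using e by measurable
  have "emeasure lborel (cylinder e I 0 r) =
      emeasure (distr (?P Basis) borel (\<lambda>f. \<Sum>b\<in>Basis. f b *\<^sub>R b)) (cylinder e I 0 r)"
    by (subst lborel_eq) simp
  also have "\<dots> = emeasure (?P Basis)
      ((\<lambda>f. \<Sum>b\<in>Basis. f b *\<^sub>R b) -` cylinder e I 0 r \<inter> space (?P Basis))"
    by (subst emeasure_distr) auto
  also have "(\<lambda>f. \<Sum>b\<in>Basis. f b *\<^sub>R b) -` cylinder e I 0 r \<inter> space (?P Basis) = ?S"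
    using e by (auto simp: cylinder_def norm_perp_basis_sum inner_sum_left_Basis)
  also have "emeasure (?P Basis) ?S = (\<integral>\<^sup>+ f. indicator ?S f \<partial>?P (insert e ?B))"
    unfolding ins by (subst nn_integral_indicator) auto
  also have "\<dots> = (\<integral>\<^sup>+ y. \<integral>\<^sup>+ x. indicator ?S (x(e := y)) \<partial>?P ?B \<partial>lborel)"
    by (rule product_nn_integral_insert_rev, simp, simp, unfold ins, rule borel_measurable_indicator[OF S])
  also have "\<dots> = (\<integral>\<^sup>+ y. \<integral>\<^sup>+ x. indicator I y * indicator ?D x \<partial>?P ?B \<partial>lborel)"
  proof (intro nn_integral_cong, goal_cases)
    case (1 y x)
    have *: "(\<Sum>b\<in>?B. ((x(e := y)) b)\<^sup>2) = (\<Sum>b\<in>?B. (x b)\<^sup>2)"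
      by (intro sum.cong) auto
    have "x(e := y) \<in> space (?P Basis)"
      using 1 e by (auto simp: space_PiM PiE_def extensional_def)
    with 1 show ?case unfolding indicator_def Int_iff mem_Collect_eq * by auto
  qed
  also have "\<dots> = (\<integral>\<^sup>+ y. indicator I y * (\<integral>\<^sup>+ x. indicator ?D x \<partial>?P ?B) \<partial>lborel)"
    by (subst nn_integral_cmult) auto
  also have "\<dots> = (\<integral>\<^sup>+ y. indicator I y \<partial>lborel) * (\<integral>\<^sup>+ x. indicator ?D x \<partial>?P ?B)"
    by (subst nn_integral_multc) auto
  also have "(\<integral>\<^sup>+ x. indicator ?D x \<partial>?P ?B) = emeasure (?P ?B) ?D"
    by (subst nn_integral_indicator) auto
  also have "\<dots> = ennreal (unit_ball_vol (real (card ?B)) * r ^ card ?B)"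
    by (rule emeasure_cball_aux) (use r in auto)
  finally show ?thesis using e by simp
qed

text \<open>Translation by \<open>q\<close> changes no axial coordinate, as \<open>q\<close> is
  orthogonal to \<open>e\<close>, so the centred case applies.\<close>

lemma emeasure_cylinder:
  fixes e :: "'v::euclidean_space"
  assumes e: "e \<in> Basis" and I[measurable]: "I \<in> sets borel" and r: "r > 0" and q: "q \<bullet> e = 0"
  shows "emeasure lborel (cylinder e I q r) =
           emeasure lborel I * ennreal (unit_ball_vol (real (DIM('v) - 1)) * r ^ (DIM('v) - 1))"
proof -
  have "emeasure lborel (cylinder e I q r) = emeasure (distr lborel borel ((+) q)) (cylinder e I q r)"
    by (simp add: lborel_distr_plus)
  also have "\<dots> = emeasure lborel ((+) q -` cylinder e I q r)"
    by (subst emeasure_distr) auto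
  also have "(+) q -` cylinder e I q r = cylinder e I 0 r"
    using q by (auto simp: cylinder_def inner_add_left perp_add perp_orthogonal)
  finally show ?thesis using emeasure_cylinder_0[OF e I r] by simp
qed


section \<open>The Poisson process of centres\<close>

lemma num_points_eq_0_iff: "num_points Y A = 0 \<longleftrightarrow> Y \<inter> A = {}"
  by (simp add: num_points_def emeasure_count_space_eq_0)

text \<open>The interface through which both bounds see the Poisson process: void probabilities
  serve the upper bound, joint occupation of disjoint sets the lower one.\<close>

locale poisson_points = prob_space M for M :: "'w measure" +
  fixes Y :: "'w \<Rightarrow> 'v::euclidean_space set" and lam :: real
  assumes lam_pos: "lam > 0"
    and void_event: "\<And>Q. Q \<in> sets borel \<Longrightarrow> {\<omega>\<in>space M. Y \<omega> \<inter> Q = {}} \<in> events"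
    and prob_void: "\<And>Q. Q \<in> sets borel \<Longrightarrow> emeasure lborel Q < \<infinity> \<Longrightarrow>
      prob {\<omega>\<in>space M. Y \<omega> \<inter> Q = {}} = exp (- (lam * measure lborel Q))"
    and prob_all_occupied: "\<And>(n::nat) A. (\<And>i. i < n \<Longrightarrow> A i \<in> sets borel \<and> emeasure lborel (A i) < \<infinity>) \<Longrightarrow>
      disjoint_family_on A {..<n} \<Longrightarrow>
      prob {\<omega>\<in>space M. \<forall>i<n. Y \<omega> \<inter> A i \<noteq> {}} = (\<Prod>i<n. 1 - exp (- (lam * measure lborel (A i))))"
begin

lemma occupied_event: "Q \<in> sets borel \<Longrightarrow> {\<omega>\<in>space M. Y \<omega> \<inter> Q \<noteq> {}} \<in> events"
  using sets.compl_sets[OF void_event[of Q]]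
  by (rule back_subst[of "\<lambda>A. A \<in> events"]) auto

end

text \<open>The orientation law is the point mass at \<open>e\<close>, so
  \<open>Q \<times> {e}\<close> has intensity \<open>lam\<close> times the volume of
  \<open>Q\<close>, and the set of points with any other direction is null and hence almost surely
  void.\<close>

lemma poisson_stick_model_rigid:
  fixes e :: "'v::euclidean_space"
  assumes e: "norm e = 1" and lam: "lam > 0"
    and model: "poisson_stick_model (rigid_orientation e) M X"
  shows "poisson_points (M lam) (\<lambda>\<omega>. {x. (x, e) \<in> X lam \<omega>}) lam"
    and "AE \<omega> in M lam. \<forall>(x, p) \<in> X lam \<omega>. p = e"
proof -
  let ?\<Theta> = "rigid_orientation e" and ?\<mu> = "stick_intensity (rigid_orientation e) lam"
  let ?Y = "\<lambda>\<omega>. {x. (x, e) \<in> X lam \<omega>}"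
  have T: "prob_space ?\<Theta>" "sets ?\<Theta> = sets (restrict_space borel (sphere 0 1))"
    and P: "poisson_point_process (M lam) ?\<mu> (X lam)"
    using model lam by (auto simp: poisson_stick_model_def)
  interpret T: prob_space ?\<Theta> by fact
  interpret prob_space "M lam" using P by (simp add: poisson_point_process_def)
  have XS: "X lam \<omega> \<subseteq> space ?\<mu>" if "\<omega> \<in> space (M lam)" for \<omega>
    using P that by (auto simp: poisson_point_process_def)
  have num[measurable]: "(\<lambda>\<omega>. num_points (X lam \<omega>) A) \<in> borel_measurable (M lam)"
    if "A \<in> sets ?\<mu>" for A
    using P that by (auto simp: poisson_point_process_def)
  have num0: "prob {\<omega>\<in>space (M lam). num_points (X lam \<omega>) A = 0} = exp (- measure ?\<mu> A)"
    if "A \<in> sets ?\<mu>" "emeasure ?\<mu> A < \<infinity>" for A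
  proof -
    have "\<forall>k::nat. prob {\<omega>\<in>space (M lam). num_points (X lam \<omega>) A = of_nat k} =
           measure ?\<mu> A ^ k / fact k * exp (- measure ?\<mu> A)"
      using P that unfolding poisson_point_process_def by blast
    from spec[OF this, of 0] show ?thesis by simp
  qed
  have ind: "indep_vars (\<lambda>_. borel) (\<lambda>i \<omega>. num_points (X lam \<omega>) (A i)) {..<n}"
    if "\<And>i. i < n \<Longrightarrow> A i \<in> sets ?\<mu>" "disjoint_family_on A {..<n}" for A and n :: nat
    using P that unfolding poisson_point_process_def by blast
  have sets_mu: "sets ?\<mu> = sets (borel \<Otimes>\<^sub>M ?\<Theta>)"
    unfolding stick_intensity_def sets_scale_measure by (rule sets_pair_measure_cong) auto
  have sp: "space ?\<Theta> = sphere 0 1"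
    unfolding rigid_orientation_def by simp
  have em: "emeasure ?\<mu> (Q \<times> B) = ennreal lam * (emeasure lborel Q * indicator B e)"
    if "Q \<in> sets borel" "B \<in> sets ?\<Theta>" for Q B
  proof -
    have "emeasure ?\<Theta> B = indicator B e"
      using that T by (simp add: rigid_orientation_def)
    then show ?thesis
      using that by (simp add: stick_intensity_def T.emeasure_pair_measure_Times)
  qed
  have B: "{e} \<in> sets ?\<Theta>" "sphere 0 1 - {e} \<in> sets ?\<Theta>"
    using e unfolding T(2) by (auto simp: sets_restrict_space_iff)
  have A: "Q \<times> {e} \<in> sets ?\<mu>" if "Q \<in> sets borel" for Q
    unfolding sets_mu using that B(1) by (rule pair_measureI)
  have emA: "emeasure ?\<mu> (Q \<times> {e}) = ennreal lam * emeasure lborel Q" if "Q \<in> sets borel" for Q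
    using em[OF that B(1)] by simp
  have mA: "measure ?\<mu> (Q \<times> {e}) = lam * measure lborel Q" if "Q \<in> sets borel" for Q
    unfolding measure_def emA[OF that] using lam by (simp add: enn2real_mult)
  have fA: "emeasure ?\<mu> (Q \<times> {e}) < \<infinity>" if "Q \<in> sets borel" "emeasure lborel Q < \<infinity>" for Q
    using emA[OF that(1)] that(2) by (simp add: ennreal_mult_less_top)
  have iff: "num_points (X lam \<omega>) (Q \<times> {e}) = 0 \<longleftrightarrow> ?Y \<omega> \<inter> Q = {}" for \<omega> Q
    unfolding num_points_eq_0_iff by auto
  show "poisson_points (M lam) ?Y lam"
  proof unfold_locales
    show "lam > 0" by fact
  next
    fix Q :: "'v set" assume Q: "Q \<in> sets borel"
    note A[OF Q, measurable]
    have "{\<omega>\<in>space (M lam). num_points (X lam \<omega>) (Q \<times> {e}) = 0} \<in> events" by measurable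
    then show "{\<omega>\<in>space (M lam). ?Y \<omega> \<inter> Q = {}} \<in> events" unfolding iff .
  next
    fix Q :: "'v set" assume Q: "Q \<in> sets borel" "emeasure lborel Q < \<infinity>"
    show "prob {\<omega>\<in>space (M lam). ?Y \<omega> \<inter> Q = {}} = exp (- (lam * measure lborel Q))"
      using num0[OF A[OF Q(1)] fA[OF Q]] unfolding iff mA[OF Q(1)] .
  next
    fix n :: nat and Q :: "nat \<Rightarrow> 'v set"
    assume Q: "\<And>i. i < n \<Longrightarrow> Q i \<in> sets borel \<and> emeasure lborel (Q i) < \<infinity>"
      and dis: "disjoint_family_on Q {..<n}"
    let ?N = "\<lambda>i \<omega>. num_points (X lam \<omega>) (Q i \<times> {e})"
    show "prob {\<omega>\<in>space (M lam). \<forall>i<n. ?Y \<omega> \<inter> Q i \<noteq> {}} =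
        (\<Prod>i<n. 1 - exp (- (lam * measure lborel (Q i))))"
    \<comment> \<open>The product formula for independent variables is applied to a nonempty index
      set, so the empty product is treated apart.\<close>
    proof (cases "n = 0")
      case True
      then show ?thesis by (simp add: prob_space)
    next
      case False
      have "indep_vars (\<lambda>_. borel) ?N {..<n}"
      proof (rule ind)
        show "Q i \<times> {e} \<in> sets ?\<mu>" if "i < n" for i using A Q that by blast
        show "disjoint_family_on (\<lambda>i. Q i \<times> {e}) {..<n}"
          using dis unfolding disjoint_family_on_def by blast
      qed
      then have "prob (\<Inter>i\<in>{..<n}. ?N i -` (- {0}) \<inter> space (M lam)) =
          (\<Prod>i\<in>{..<n}. prob (?N i -` (- {0}) \<inter> space (M lam)))"
        by (rule indep_varsD_finite) (use False in auto)
      also have "(\<Inter>i\<in>{..<n}. ?N i -` (- {0}) \<inter> space (M lam)) =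
          {\<omega>\<in>space (M lam). \<forall>i<n. ?Y \<omega> \<inter> Q i \<noteq> {}}"
        using False unfolding iff[symmetric] by auto
      also have "(\<Prod>i\<in>{..<n}. prob (?N i -` (- {0}) \<inter> space (M lam))) =
          (\<Prod>i<n. 1 - exp (- (lam * measure lborel (Q i))))"
      proof (rule prod.cong)
        fix i assume "i \<in> {..<n}"
        then have Qi: "Q i \<in> sets borel" "emeasure lborel (Q i) < \<infinity>" using Q by auto
        note A[OF Qi(1), measurable]
        have "prob (space (M lam) - {\<omega>\<in>space (M lam). ?N i \<omega> = 0}) =
            1 - prob {\<omega>\<in>space (M lam). ?N i \<omega> = 0}"
          by (rule prob_compl) measurable
        moreover have "space (M lam) - {\<omega>\<in>space (M lam). ?N i \<omega> = 0} =
            ?N i -` (- {0}) \<inter> space (M lam)" by auto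
        ultimately show "prob (?N i -` (- {0}) \<inter> space (M lam)) =
            1 - exp (- (lam * measure lborel (Q i)))"
          using num0[OF A[OF Qi(1)] fA[OF Qi]] mA[OF Qi(1)] by simp
      qed simp
      finally show ?thesis .
    qed
  qed
  let ?C = "UNIV \<times> (sphere 0 1 - {e})"
  have C[measurable]: "?C \<in> sets ?\<mu>"
    unfolding sets_mu using B by (intro pair_measureI) auto
  have em0: "emeasure ?\<mu> ?C = 0"
    using em[OF _ B(2), of UNIV] by simp
  have "prob {\<omega>\<in>space (M lam). num_points (X lam \<omega>) ?C = 0} = 1"
    using num0[OF C] em0 by (simp add: measure_def)
  then have "AE \<omega> in M lam. num_points (X lam \<omega>) ?C = 0"
    by (subst (asm) prob_Collect_eq_1) measurable
  then show "AE \<omega> in M lam. \<forall>(x, p) \<in> X lam \<omega>. p = e"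
    using AE_space
  proof eventually_elim
    case (elim \<omega>)
    then have "X lam \<omega> \<inter> ?C = {}" by (simp add: num_points_eq_0_iff)
    moreover have "space ?\<mu> = UNIV \<times> sphere 0 1"
      by (simp add: stick_intensity_def space_scale_measure space_pair_measure sp)
    ultimately show ?case using XS[OF elim(2)] by blast
  qed
qed


section \<open>Parallel sticks\<close>

text \<open>The axis segment is compact and nonempty, so the infimum distance is attained at some
  parameter \<open>t\<close>.\<close>

lemma mem_stick_iff:
  assumes "L \<ge> 0"
  shows "y \<in> stick L (x, p) \<longleftrightarrow> (\<exists>t. \<bar>t\<bar> \<le> L / 2 \<and> dist y (x + t *\<^sub>R p) \<le> 1)"
proof -
  let ?S = "(\<lambda>t. x + t *\<^sub>R p) ` {- (L / 2)..L / 2}"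
  have S: "{x + t *\<^sub>R p | t. - L / 2 \<le> t \<and> t \<le> L / 2} = ?S" by auto
  have "compact ?S"
    by (intro compact_continuous_image continuous_intros compact_Icc)
  then have closed: "closed ?S" by (rule compact_imp_closed)
  have ne: "?S \<noteq> {}" using assms by auto
  have "infdist y ?S \<le> 1 \<longleftrightarrow> (\<exists>z\<in>?S. dist y z \<le> 1)"
    using infdist_attains_inf[OF closed ne, of y] by (metis infdist_le2)
  moreover have "\<bar>t\<bar> \<le> L / 2 \<longleftrightarrow> t \<in> {- (L / 2)..L / 2}" for t by (auto simp: abs_le_iff)
  moreover have "y \<in> stick L (x, p) \<longleftrightarrow> infdist y ?S \<le> 1"
    by (simp only: stick_def prod.case mem_Collect_eq S)
  ultimately show ?thesis by auto
qed

text \<open>A stick is the sum of a segment and a unit ball, hence a continuous image of a convex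
  set.\<close>

lemma connected_stick:
  assumes "L \<ge> 0"
  shows "connected (stick L (x, p))"
proof -
  have "stick L (x, p) = (\<lambda>(t, u). x + t *\<^sub>R p + u) ` ({- (L / 2)..L / 2} \<times> cball 0 1)"
  proof (intro set_eqI iffI)
    fix y assume "y \<in> stick L (x, p)"
    then obtain t where "\<bar>t\<bar> \<le> L / 2" "dist y (x + t *\<^sub>R p) \<le> 1"
      using assms by (auto simp: mem_stick_iff)
    then show "y \<in> (\<lambda>(t, u). x + t *\<^sub>R p + u) ` ({- (L / 2)..L / 2} \<times> cball 0 1)"
      by (intro image_eqI[where x = "(t, y - (x + t *\<^sub>R p))"]) (auto simp: dist_norm norm_minus_commute)
  next
    fix y assume "y \<in> (\<lambda>(t, u). x + t *\<^sub>R p + u) ` ({- (L / 2)..L / 2} \<times> cball 0 1)"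
    then obtain t u where tu: "t \<in> {- (L / 2)..L / 2}" "u \<in> cball 0 1" "y = x + t *\<^sub>R p + u"
      by (auto simp only: image_iff mem_Times_iff split_beta fst_conv snd_conv)
    then show "y \<in> stick L (x, p)"
      unfolding mem_stick_iff[OF assms] using tu by (intro exI[of _ t]) (auto simp: dist_norm abs_le_iff)
  qed
  moreover have "connected ({- (L / 2)..L / 2} \<times> cball (0::'a) 1)"
    by (intro convex_connected convex_Times) auto
  ultimately show ?thesis
    by (auto intro!: connected_continuous_image continuous_intros simp: case_prod_unfold)
qed

lemma center_in_stick: "L \<ge> 0 \<Longrightarrow> x \<in> stick L (x, p)"
  by (auto simp: mem_stick_iff intro!: exI[of _ 0])

text \<open>Each centre is slid along its own axis by half of the axial difference. The resulting
  points \<open>a\<close> and \<open>b\<close> differ only perpendicularly, by at most 2, so their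
  midpoint lies in both sticks.\<close>

lemma sticks_meet:
  fixes e :: "'v::euclidean_space"
  assumes e: "norm e = 1" and L: "L \<ge> 0"
    and axial: "\<bar>x \<bullet> e - y \<bullet> e\<bar> \<le> L" and radial: "norm (perp e x - perp e y) \<le> 2"
  shows "stick L (x, e) \<inter> stick L (y, e) \<noteq> {}"
proof -
  define s where "s = (y \<bullet> e - x \<bullet> e) / 2"
  define a b where "a = x + s *\<^sub>R e" and "b = y + (- s) *\<^sub>R e"
  have "a - b = perp e x - perp e y"
    unfolding a_def b_def s_def perp_def by (simp add: algebra_simps flip: scaleR_add_left)
  then have "dist a b \<le> 2" using radial by (simp add: dist_norm)
  then have "dist (midpoint a b) a \<le> 1" "dist (midpoint a b) b \<le> 1"
    by (simp_all add: dist_midpoint)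
  moreover have "\<bar>s\<bar> \<le> L / 2" "\<bar>- s\<bar> \<le> L / 2" using axial by (auto simp: s_def)
  ultimately have "midpoint a b \<in> stick L (x, e)" "midpoint a b \<in> stick L (y, e)"
    using L unfolding mem_stick_iff[OF L] a_def b_def by blast+
  then show ?thesis by blast
qed

text \<open>Converse tool to \<open>sticks_meet\<close>: applied to two sticks with a common point,
  it puts the centres within \<open>L + 2\<close> axially and 2 radially.\<close>

lemma stick_offset:
  fixes e :: "'v::euclidean_space"
  assumes e: "norm e = 1" and L: "L \<ge> 0" and u: "u \<in> stick L (x, e)"
  shows "\<bar>u \<bullet> e - x \<bullet> e\<bar> \<le> L / 2 + 1" "norm (perp e u - perp e x) \<le> 1"
proof -
  obtain t where t: "\<bar>t\<bar> \<le> L / 2" "norm (u - (x + t *\<^sub>R e)) \<le> 1"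
    using u by (auto simp: mem_stick_iff[OF L] dist_norm)
  have "\<bar>(u - (x + t *\<^sub>R e)) \<bullet> e\<bar> \<le> 1"
    using Cauchy_Schwarz_ineq2[of "u - (x + t *\<^sub>R e)" e] e t by simp
  then have "\<bar>u \<bullet> e - x \<bullet> e - t\<bar> \<le> 1"
    using e by (simp add: inner_diff_left inner_add_left dot_square_norm algebra_simps)
  then show "\<bar>u \<bullet> e - x \<bullet> e\<bar> \<le> L / 2 + 1" using t(1) by linarith
  have "perp e (u - (x + t *\<^sub>R e)) = perp e u - perp e x"
    by (simp add: perp_diff perp_add perp_scaleR_axis[OF e])
  then show "norm (perp e u - perp e x) \<le> 1"
    using norm_perp_le[OF e, of "u - (x + t *\<^sub>R e)"] t by simp
qed

lemma connected_UN_pairwise: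
  assumes "\<And>i. i \<in> I \<Longrightarrow> connected (S i)"
    and "\<And>i j. i \<in> I \<Longrightarrow> j \<in> I \<Longrightarrow> S i \<inter> S j \<noteq> {}"
  shows "connected (\<Union>i\<in>I. S i)"
proof (cases "I = {}")
  case False
  then obtain k where k: "k \<in> I" by auto
  have "(\<Union>i\<in>I. S i) = \<Union> ((\<lambda>i. S k \<union> S i) ` I)" using k by auto
  also have "connected \<dots>"
    by (rule connected_Union) (use assms k in \<open>auto intro!: connected_Un\<close>)
  finally show ?thesis .
qed auto


section \<open>Hierarchically good blocks\<close>

text \<open>A block of level \<open>n\<close> is a square of \<open>3 ^ n\<close> by \<open>3 ^ n\<close> cells, indexed by the common value of
  \<open>div 3 ^ n\<close> on the two cell indices.\<close>

definition subblocks :: "nat \<times> nat \<Rightarrow> (nat \<times> nat) set" where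
  "subblocks p = {q. fst q div 3 = fst p \<and> snd q div 3 = snd p}"

primrec good :: "(nat \<times> nat \<Rightarrow> bool) \<Rightarrow> nat \<Rightarrow> nat \<times> nat \<Rightarrow> bool" where
  "good occ 0 p = occ p"
| "good occ (Suc n) p =
     (\<forall>q\<in>subblocks p. \<forall>q'\<in>subblocks p. \<not> good occ n q \<longrightarrow> \<not> good occ n q' \<longrightarrow> q = q')"

text \<open>Only good subblocks contribute; occupied cells inside a bad subblock are discarded,
  since nothing ties them to the rest. The value is meaningful for good blocks only.\<close>

primrec region :: "(nat \<times> nat \<Rightarrow> bool) \<Rightarrow> (nat \<times> nat \<Rightarrow> 'v set) \<Rightarrow> nat \<Rightarrow> nat \<times> nat \<Rightarrow> 'v set" where
  "region occ S 0 p = S p"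
| "region occ S (Suc n) p = (\<Union>q\<in>{q \<in> subblocks p. good occ n q}. region occ S n q)"

text \<open>Sets of cells whose vacancy certifies that a block is bad. They are fixed in advance, and the
  vacancy of each is a single void event of the Poisson process, so no independence is used.\<close>

primrec witnesses :: "nat \<Rightarrow> nat \<times> nat \<Rightarrow> (nat \<times> nat) set set" where
  "witnesses 0 p = {{p}}"
| "witnesses (Suc n) p =
     (\<Union>(q, q')\<in>{(q, q') \<in> subblocks p \<times> subblocks p. q \<noteq> q'}.
        (\<lambda>(A, B). A \<union> B) ` (witnesses n q \<times> witnesses n q'))"

section \<open>Counting the witness sets\<close>

lemma subblocks_eq:
  "subblocks (a, b) = (\<lambda>(s, t). (3 * a + s, 3 * b + t)) ` ({..<3} \<times> {..<3})"
proof (intro set_eqI iffI)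
  fix q assume "q \<in> subblocks (a, b)"
  then have "q = (3 * a + fst q mod 3, 3 * b + snd q mod 3)"
    by (auto simp: subblocks_def)
  then show "q \<in> (\<lambda>(s, t). (3 * a + s, 3 * b + t)) ` ({..<3} \<times> {..<3})"
    by (intro image_eqI[where x = "(fst q mod 3, snd q mod 3)"]) auto
qed (auto simp: subblocks_def)

lemma finite_subblocks [simp]: "finite (subblocks p)"
  by (cases p) (simp add: subblocks_eq)

lemma card_subblocks_le: "card (subblocks p) \<le> 9"
proof -
  have "card (subblocks p) \<le> card ({..<3::nat} \<times> {..<3::nat})"
    by (cases p, simp only: subblocks_eq) (rule card_image_le, simp)
  then show ?thesis by simp
qed

lemma finite_witnesses [simp]: "finite (witnesses n p)"
proof (induction n arbitrary: p)
  case (Suc n)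
  have "finite {(q, q') \<in> subblocks p \<times> subblocks p. q \<noteq> q'}"
    by (rule finite_subset[of _ "subblocks p \<times> subblocks p"]) auto
  then show ?case
    unfolding witnesses.simps by (rule finite_UN_I) (auto intro!: finite_imageI finite_cartesian_product Suc.IH)
qed simp

text \<open>There are at most \<open>9 * 9 = 81\<close> ordered pairs of subblocks, so the counts
  satisfy \<open>c (n + 1) \<le> 81 * (c n)\<^sup>2\<close> with \<open>c 0 = 1\<close>; the
  exponents of 81 follow \<open>k \<mapsto> 2 * k + 1\<close> from 0.\<close>

lemma card_witnesses_le: "card (witnesses n p) \<le> 81 ^ (2 ^ n - 1)"
proof (induction n arbitrary: p)
  case (Suc n)
  let ?P = "{(q, q') \<in> subblocks p \<times> subblocks p. q \<noteq> q'}"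
  have P: "finite ?P" "card ?P \<le> 81"
  proof -
    show "finite ?P" by (rule finite_subset[of _ "subblocks p \<times> subblocks p"]) auto
    have "card ?P \<le> card (subblocks p \<times> subblocks p)" by (rule card_mono) auto
    also have "\<dots> \<le> 9 * 9"
      unfolding card_cartesian_product by (intro mult_mono card_subblocks_le) auto
    finally show "card ?P \<le> 81" by simp
  qed
  have "card (witnesses (Suc n) p) \<le> (\<Sum>(q, q')\<in>?P.
      card ((\<lambda>(A, B). A \<union> B) ` (witnesses n q \<times> witnesses n q')))"
    unfolding witnesses.simps case_prod_unfold by (rule card_UN_le) (use P in \<open>simp add: case_prod_unfold\<close>)
  also have "\<dots> \<le> (\<Sum>(q, q')\<in>?P. 81 ^ (2 ^ n - 1) * 81 ^ (2 ^ n - 1))"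
    unfolding case_prod_unfold
  proof (rule sum_mono)
    fix x
    have "card ((\<lambda>x. fst x \<union> snd x) ` (witnesses n (fst x) \<times> witnesses n (snd x)))
        \<le> card (witnesses n (fst x) \<times> witnesses n (snd x))"
      by (rule card_image_le) auto
    also have "\<dots> \<le> 81 ^ (2 ^ n - 1) * 81 ^ (2 ^ n - 1)"
      unfolding card_cartesian_product by (intro mult_mono Suc.IH) auto
    finally show "card ((\<lambda>x. fst x \<union> snd x) ` (witnesses n (fst x) \<times> witnesses n (snd x)))
        \<le> 81 ^ (2 ^ n - 1) * 81 ^ (2 ^ n - 1)" .
  qed
  also have "\<dots> \<le> 81 * (81 ^ (2 ^ n - 1) * 81 ^ (2 ^ n - 1))"
    using P by simp
  also have "\<dots> = 81 ^ (2 ^ Suc n - 1)"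
  proof -
    have "2 ^ Suc n - 1 = Suc ((2 ^ n - 1) + (2 ^ n - 1 :: nat))"
      using one_le_power[of "2::nat" n] unfolding power_Suc by linarith
    then show ?thesis by (simp only: power_Suc power_add)
  qed
  finally show ?case .
qed auto

text \<open>Confines a witness to its block, so that witnesses of distinct blocks of one level are
  disjoint and their sizes add up exactly.\<close>

lemma witnesses_in_block:
  assumes "F \<in> witnesses n p" "c \<in> F"
  shows "fst c div 3 ^ n = fst p \<and> snd c div 3 ^ n = snd p"
  using assms
proof (induction n arbitrary: F p)
  case (Suc n)
  then obtain A q where "q \<in> subblocks p" "A \<in> witnesses n q" "c \<in> A" by auto
  moreover from this have "fst c div 3 ^ n = fst q" "snd c div 3 ^ n = snd q"
    using Suc.IH by auto
  ultimately show ?case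
    by (auto simp: subblocks_def div_mult2_eq power_Suc2 simp del: power_Suc)
qed auto

lemma card_witness:
  assumes "F \<in> witnesses n p"
  shows "finite F \<and> card F = 2 ^ n"
  using assms
proof (induction n arbitrary: F p)
  case (Suc n)
  then obtain A B q q' where F: "F = A \<union> B" "A \<in> witnesses n q" "B \<in> witnesses n q'" "q \<noteq> q'" by auto
  have "A \<inter> B = {}"
    using witnesses_in_block[OF F(2)] witnesses_in_block[OF F(3)] F(4)
    by (metis disjoint_iff prod.expand)
  then show ?case using Suc.IH[OF F(2)] Suc.IH[OF F(3)] F(1) by (simp add: card_Un_disjoint)
qed auto

text \<open>A bad block has two distinct bad subblocks; the union of their witnesses is a witness
  for the block.\<close>

lemma not_good_witness:
  assumes "\<not> good occ n p"
  obtains F where "F \<in> witnesses n p" "\<And>c. c \<in> F \<Longrightarrow> \<not> occ c"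
  using assms
proof (induction n arbitrary: p thesis)
  case 0
  then show ?case by auto
next
  case (Suc n)
  then obtain q q' where q: "q \<in> subblocks p" "q' \<in> subblocks p" "\<not> good occ n q" "\<not> good occ n q'"
    "q \<noteq> q'" by auto
  obtain A where A: "A \<in> witnesses n q" "\<And>c. c \<in> A \<Longrightarrow> \<not> occ c" using Suc.IH[OF _ q(3)] by blast
  obtain B where B: "B \<in> witnesses n q'" "\<And>c. c \<in> B \<Longrightarrow> \<not> occ c" using Suc.IH[OF _ q(4)] by blast
  show ?case
  proof (rule Suc.prems(1))
    show "A \<union> B \<in> witnesses (Suc n) p"
      unfolding witnesses.simps
      by (rule UN_I[of "(q, q')"]) (use q A B in \<open>auto intro!: image_eqI[where x = "(A, B)"]\<close>)
  qed (use A B in auto)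
qed


section \<open>Connectivity of good blocks\<close>

lemma common_good_index:
  assumes P: "\<And>s t::nat. s < 3 \<Longrightarrow> t < 3 \<Longrightarrow> s \<noteq> t \<Longrightarrow> P s \<or> P t"
    and Q: "\<And>s t::nat. s < 3 \<Longrightarrow> t < 3 \<Longrightarrow> s \<noteq> t \<Longrightarrow> Q s \<or> Q t"
  shows "\<exists>t<3. P t \<and> Q t"
proof -
  \<comment> \<open>Each predicate fails for at most one of the three indices, so at least one index
    survives both.\<close>
  have "P 0 \<or> P 1" "P 0 \<or> P 2" "P 1 \<or> P 2" by (rule P; simp)+
  moreover have "Q 0 \<or> Q 1" "Q 0 \<or> Q 2" "Q 1 \<or> Q 2" by (rule Q; simp)+
  moreover have "(0::nat) < 3" "(1::nat) < 3" "(2::nat) < 3" by simp_all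
  ultimately show ?thesis by blast
qed

locale occupied_cells =
  fixes occ :: "nat \<times> nat \<Rightarrow> bool" and S :: "nat \<times> nat \<Rightarrow> 'v::real_normed_vector set"
  assumes connected_cell: "\<And>p. occ p \<Longrightarrow> connected (S p)"
    and nonempty_cell: "\<And>p. occ p \<Longrightarrow> S p \<noteq> {}"
    and adjacent_right: "\<And>a b. occ (a, b) \<Longrightarrow> occ (Suc a, b) \<Longrightarrow> S (a, b) \<inter> S (Suc a, b) \<noteq> {}"
    and adjacent_up: "\<And>a b. occ (a, b) \<Longrightarrow> occ (a, Suc b) \<Longrightarrow> S (a, b) \<inter> S (a, Suc b) \<noteq> {}"
begin

abbreviation "G \<equiv> good occ"
abbreviation "R \<equiv> region occ S"

lemma in_subblocks: "s < 3 \<Longrightarrow> t < 3 \<Longrightarrow> (3 * a + s, 3 * b + t) \<in> subblocks (a, b)"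
  by (auto simp: subblocks_def)

lemma good_subblock_one_of_two:
  assumes "G (Suc n) p" "q \<in> subblocks p" "q' \<in> subblocks p" "q \<noteq> q'"
  shows "G n q \<or> G n q'"
  using assms by auto

lemma region_subblock: "q \<in> subblocks p \<Longrightarrow> G n q \<Longrightarrow> R n q \<subseteq> R (Suc n) p"
  by auto

text \<open>The last column of subblocks of the left block faces the first column of the right
  block. Each column has at most one bad subblock, so in some row both are good, and these are
  neighbours one level down.\<close>

lemma regions_meet_right: "G n (a, b) \<Longrightarrow> G n (Suc a, b) \<Longrightarrow> R n (a, b) \<inter> R n (Suc a, b) \<noteq> {}"
proof (induction n arbitrary: a b)
  case 0
  then show ?case using adjacent_right by simp
next
  case (Suc n)
  let ?l = "\<lambda>t. (3 * a + 2, 3 * b + t)" and ?r = "\<lambda>t. (3 * Suc a + 0, 3 * b + t)"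
  have l: "G n (?l s) \<or> G n (?l t)" and r: "G n (?r s) \<or> G n (?r t)"
    if "s < 3" "t < 3" "s \<noteq> t" for s t
    using good_subblock_one_of_two[OF Suc.prems(1) in_subblocks[of 2 s] in_subblocks[of 2 t]]
      good_subblock_one_of_two[OF Suc.prems(2) in_subblocks[of 0 s] in_subblocks[of 0 t]] that by auto
  obtain t where t: "t < 3" "G n (?l t)" "G n (?r t)"
    using common_good_index[of "\<lambda>t. G n (?l t)" "\<lambda>t. G n (?r t)"] l r by blast
  have "R n (?l t) \<inter> R n (?r t) \<noteq> {}"
    using Suc.IH[of "3 * a + 2" "3 * b + t"] t by (simp add: numeral_3_eq_3)
  moreover have "R n (?l t) \<subseteq> R (Suc n) (a, b)" "R n (?r t) \<subseteq> R (Suc n) (Suc a, b)"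
    using region_subblock[OF in_subblocks[of 2 t] t(2)] region_subblock[OF in_subblocks[of 0 t] t(3)]
      t(1) by (simp_all del: region.simps)
  ultimately show ?case by blast
qed

lemma regions_meet_up: "G n (a, b) \<Longrightarrow> G n (a, Suc b) \<Longrightarrow> R n (a, b) \<inter> R n (a, Suc b) \<noteq> {}"
proof (induction n arbitrary: a b)
  case 0
  then show ?case using adjacent_up by simp
next
  case (Suc n)
  let ?l = "\<lambda>t. (3 * a + t, 3 * b + 2)" and ?r = "\<lambda>t. (3 * a + t, 3 * Suc b + 0)"
  have l: "G n (?l s) \<or> G n (?l t)" and r: "G n (?r s) \<or> G n (?r t)"
    if "s < 3" "t < 3" "s \<noteq> t" for s t
    using good_subblock_one_of_two[OF Suc.prems(1) in_subblocks[of s 2] in_subblocks[of t 2]]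
      good_subblock_one_of_two[OF Suc.prems(2) in_subblocks[of s 0] in_subblocks[of t 0]] that by auto
  obtain t where t: "t < 3" "G n (?l t)" "G n (?r t)"
    using common_good_index[of "\<lambda>t. G n (?l t)" "\<lambda>t. G n (?r t)"] l r by blast
  have "R n (?l t) \<inter> R n (?r t) \<noteq> {}"
    using Suc.IH[of "3 * a + t" "3 * b + 2"] t by (simp add: numeral_3_eq_3)
  moreover have "R n (?l t) \<subseteq> R (Suc n) (a, b)" "R n (?r t) \<subseteq> R (Suc n) (a, Suc b)"
    using region_subblock[OF in_subblocks[of t 2] t(2)] region_subblock[OF in_subblocks[of t 0] t(3)]
      t(1) by (simp_all del: region.simps)
  ultimately show ?case by blast
qed

text \<open>Descends through good subblocks. The first index is tracked because it later forces the
  union of regions to be unbounded.\<close>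

lemma good_contains_cell:
  assumes "G n p"
  shows "\<exists>c. occ c \<and> fst c div 3 ^ n = fst p \<and> S c \<subseteq> R n p"
  using assms
proof (induction n arbitrary: p)
  case (Suc n)
  obtain a b where p: "p = (a, b)" by (cases p)
  obtain q where q: "q \<in> subblocks p" "G n q"
    using good_subblock_one_of_two[OF Suc.prems[unfolded p] in_subblocks[of 0 0] in_subblocks[of 0 1]]
      in_subblocks[of 0 0 a b] in_subblocks[of 0 1 a b] p by auto
  obtain c where c: "occ c" "fst c div 3 ^ n = fst q" "S c \<subseteq> R n q" using Suc.IH[OF q(2)] by blast
  have "fst c div 3 ^ Suc n = fst p"
    using c(2) q(1) by (simp add: subblocks_def div_mult2_eq power_Suc2 del: power_Suc)
  with c region_subblock[OF q] show ?case by blast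
qed auto

lemma connected_region: "G n p \<Longrightarrow> connected (R n p)"
proof (induction n arbitrary: p)
  case 0
  then show ?case using connected_cell by simp
next
  case (Suc n)
  obtain a b where p: "p = (a, b)" by (cases p)
  let ?U = "R (Suc n) p"
  let ?q = "\<lambda>s t. (3 * a + s, 3 * b + t)"
  define g where "g s t = G n (?q s t)" for s t
  define J where "J q q' \<longleftrightarrow> (\<forall>x\<in>R n q. \<forall>y\<in>R n q'. connected_component ?U x y)" for q q'
  have ne: "R n q \<noteq> {}" if "G n q" for q
    using good_contains_cell[OF that] nonempty_cell by blast
  have sub: "R n (?q s t) \<subseteq> ?U" if "s < 3" "t < 3" "g s t" for s t
    using region_subblock[OF in_subblocks] that p by (simp add: g_def del: region.simps)
  have J_sym: "J q q'" if "J q' q" for q q'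
    using that unfolding J_def by (blast intro: connected_component_sym)
  \<comment> \<open>\<open>J\<close> holds vacuously when a region is empty, so transitivity needs a
    good, hence nonempty, middle block.\<close>
  have J_trans: "J q q''" if "J q q'" "J q' q''" "G n q'" for q q' q''
    using that(1,2) ne[OF that(3)] unfolding J_def by (blast intro: connected_component_trans)
  have J_meet: "J (?q s t) (?q s' t')"
    if "s < 3" "t < 3" "s' < 3" "t' < 3" "g s t" "g s' t'" "R n (?q s t) \<inter> R n (?q s' t') \<noteq> {}"
    for s t s' t'
  proof -
    have "connected (R n (?q s t) \<union> R n (?q s' t'))"
      by (rule connected_Un) (use that Suc.IH g_def in auto)
    moreover have "R n (?q s t) \<union> R n (?q s' t') \<subseteq> ?U" using sub that by blast
    ultimately show ?thesis unfolding J_def connected_component_def by blast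
  qed
  have J_right: "J (?q s t) (?q (Suc s) t)" if "s < 2" "t < 3" "g s t" "g (Suc s) t" for s t
    by (rule J_meet) (use that regions_meet_right[of n "3 * a + s" "3 * b + t"] in \<open>auto simp: g_def\<close>)
  have J_up: "J (?q s t) (?q s (Suc t))" if "s < 3" "t < 2" "g s t" "g s (Suc t)" for s t
    by (rule J_meet) (use that regions_meet_up[of n "3 * a + s" "3 * b + t"] in \<open>auto simp: g_def\<close>)
  have one: "g s t \<or> g s' t'" if "s < 3" "t < 3" "s' < 3" "t' < 3" "(s, t) \<noteq> (s', t')" for s t s' t'
    using good_subblock_one_of_two[OF Suc.prems[unfolded p] in_subblocks[of s t] in_subblocks[of s' t']] that
    by (auto simp: g_def)
  txt \<open>Removing one square from a 3 by 3 board leaves it connected: the centre, or a corner if the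
    centre is missing, serves as the hub.\<close>
  have "\<exists>k. G n k \<and> (\<forall>s<3. \<forall>t<3. g s t \<longrightarrow> J (?q s t) k)"
  proof (cases "g 1 1")
    case True
    let ?k = "?q 1 1"
    have k: "G n ?k" using True by (simp add: g_def)
    have edge: "g 0 1 \<Longrightarrow> J (?q 0 1) ?k" "g 2 1 \<Longrightarrow> J (?q 2 1) ?k"
      "g 1 0 \<Longrightarrow> J (?q 1 0) ?k" "g 1 2 \<Longrightarrow> J (?q 1 2) ?k"
      using J_right[of 0 1] J_right[of 1 1, THEN J_sym] J_up[of 1 0] J_up[of 1 1, THEN J_sym] True
      by (auto simp: numeral_2_eq_2)
    have tr: "J (?q s t) ?k" if "J (?q s t) (?q s' t')" "g s' t'" "J (?q s' t') ?k" for s t s' t'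
      using J_trans[OF that(1) that(3)] that(2) by (simp add: g_def)
    \<comment> \<open>A corner has two edge neighbours; at most one of them is bad, and the other
      leads to the centre.\<close>
    have corner: "J (?q 0 0) ?k" if "g 0 0"
      using one[of 0 1 1 0] tr[OF J_right[of 0 0]] tr[OF J_up[of 0 0]] edge that by auto
    have corner2: "J (?q 2 0) ?k" if "g 2 0"
      using one[of 2 1 1 0] tr[OF J_right[of 1 0, THEN J_sym]] tr[OF J_up[of 2 0]] edge that
      by (auto simp: numeral_2_eq_2)
    have corner3: "J (?q 0 2) ?k" if "g 0 2"
      using one[of 0 1 1 2] tr[OF J_right[of 0 2]] tr[OF J_up[of 0 1, THEN J_sym]] edge that
      by (auto simp: numeral_2_eq_2)
    have corner4: "J (?q 2 2) ?k" if "g 2 2"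
      using one[of 2 1 1 2] tr[OF J_right[of 1 2, THEN J_sym]] tr[OF J_up[of 2 1, THEN J_sym]] edge that
      by (auto simp: numeral_2_eq_2)
    have self: "J ?k ?k"
      using J_meet[of 1 1 1 1] ne[OF k] True by simp
    have "J (?q s t) ?k" if "s < 3" "t < 3" "g s t" for s t
    proof -
      have "s = 0 \<or> s = 1 \<or> s = 2" "t = 0 \<or> t = 1 \<or> t = 2" using that by auto
      then show ?thesis using that edge corner corner2 corner3 corner4 self by metis
    qed
    with k show ?thesis by blast
  next
    case False
    \<comment> \<open>The centre is the one bad square, so the surrounding ring of eight is entirely
      good and is walked in both directions from \<open>(0, 0)\<close>.\<close>
    have g: "g s t" if "s < 3" "t < 3" "(s, t) \<noteq> (1, 1)" for s t
      using one[of s t 1 1] that False by auto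
    let ?k = "?q 0 0"
    have tr: "J (?q s t) ?k" if "J (?q s t) (?q s' t')" "J (?q s' t') ?k" "g s' t'" for s t s' t'
      using J_trans[OF that(1,2)] that(3) by (simp add: g_def)
    have k: "G n ?k" using g[of 0 0] by (simp add: g_def)
    have j00: "J (?q 0 0) ?k" using J_meet[of 0 0 0 0] ne[OF k] g[of 0 0] by simp
    have j10: "J (?q 1 0) ?k" using J_right[of 0 0, THEN J_sym] g[of 0 0] g[of 1 0] by simp
    have j01: "J (?q 0 1) ?k" using J_up[of 0 0, THEN J_sym] g[of 0 0] g[of 0 1] by simp
    have j20: "J (?q 2 0) ?k"
      using tr[OF J_right[of 1 0, THEN J_sym] j10] g[of 1 0] g[of 2 0] by (simp add: numeral_2_eq_2)
    have j02: "J (?q 0 2) ?k"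
      using tr[OF J_up[of 0 1, THEN J_sym] j01] g[of 0 1] g[of 0 2] by (simp add: numeral_2_eq_2)
    have j21: "J (?q 2 1) ?k"
      using tr[OF J_up[of 2 0, THEN J_sym] j20] g[of 2 1] g[of 2 0] by (simp add: numeral_2_eq_2)
    have j12: "J (?q 1 2) ?k"
      using tr[OF J_right[of 0 2, THEN J_sym]] j02 g[of 1 2] g[of 0 2] by (simp add: numeral_2_eq_2)
    have j22: "J (?q 2 2) ?k"
      using tr[OF J_up[of 2 1, THEN J_sym]] j21 g[of 2 2] g[of 2 1] by (simp add: numeral_2_eq_2)
    have "J (?q s t) ?k" if "s < 3" "t < 3" "g s t" for s t
    proof -
      have "s = 0 \<or> s = 1 \<or> s = 2" "t = 0 \<or> t = 1 \<or> t = 2" using that by auto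
      then show ?thesis using that False j00 j10 j01 j20 j02 j21 j12 j22 by metis
    qed
    with k show ?thesis by blast
  qed
  then obtain k where k: "G n k" "\<And>s t. s < 3 \<Longrightarrow> t < 3 \<Longrightarrow> g s t \<Longrightarrow> J (?q s t) k" by blast
  have Jk: "J q k" if "q \<in> subblocks p" "G n q" for q
    using that k(2) unfolding p subblocks_eq by (auto simp: g_def)
  show ?case
    unfolding connected_iff_connected_component
  proof (intro ballI)
    fix x y assume "x \<in> ?U" "y \<in> ?U"
    then obtain q q' where q: "q \<in> subblocks p" "G n q" "x \<in> R n q"
      and q': "q' \<in> subblocks p" "G n q'" "y \<in> R n q'" by auto
    have "J q q'" using J_trans[OF Jk[OF q(1,2)] J_sym[OF Jk[OF q'(1,2)]] k(1)] .
    then show "connected_component ?U x y" using q q' unfolding J_def by blast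
  qed
qed

lemma eventually_good_connected_union:
  assumes "\<And>n. n \<ge> N \<Longrightarrow> G n (0, 0)"
  obtains U where "connected U" "U \<subseteq> (\<Union>c\<in>{c. occ c}. S c)"
    "\<And>m::nat. \<exists>c. occ c \<and> fst c \<ge> m \<and> S c \<subseteq> U"
proof
  let ?U = "\<Union>n\<in>{N..}. R n (0, 0)"
  \<comment> \<open>Block \<open>(0, 0)\<close> of one level is a subblock of block
    \<open>(0, 0)\<close> of the next, so the regions increase.\<close>
  have le_Suc: "R n (0, 0) \<subseteq> R (Suc n) (0, 0)" if "n \<ge> N" for n
    by (rule region_subblock) (use assms[OF that] in \<open>auto simp: subblocks_def\<close>)
  have mono: "R n (0, 0) \<subseteq> R m (0, 0)" if "N \<le> n" "n \<le> m" for n m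
    using that(2)
  proof (induction rule: dec_induct)
    case (step k)
    then show ?case using le_Suc[of k] that(1) by (meson order_trans)
  qed simp
  have ne: "R n (0, 0) \<noteq> {}" if "n \<ge> N" for n
    using good_contains_cell[OF assms[OF that]] nonempty_cell by blast
  show "connected ?U"
  proof (rule connected_UN_pairwise)
    fix i j assume "i \<in> {N..}" "j \<in> {N..}"
    then show "R i (0, 0) \<inter> R j (0, 0) \<noteq> {}"
      using mono[of i j] mono[of j i] ne[of i] ne[of j] by (cases "i \<le> j") auto
  qed (use assms connected_region in auto)
  have "R n p \<subseteq> (\<Union>c\<in>{c. occ c}. S c)" if "G n p" for n p
    using that
  proof (induction n arbitrary: p)
    case (Suc n)
    then show ?case by (simp add: UN_subset_iff)
  qed auto
  then show "?U \<subseteq> (\<Union>c\<in>{c. occ c}. S c)" using assms by blast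
  fix m :: nat
  define n where "n = max N m"
  have n: "n \<ge> N" "n \<ge> m" by (auto simp: n_def)
  \<comment> \<open>Two subblocks in the column farthest from the origin: one of them is good, and
    its cells have first index at least \<open>2 * 3 ^ n\<close>.\<close>
  have in0: "(2, 0) \<in> subblocks (0, 0)" "(2, 1) \<in> subblocks (0, 0)"
    by (auto simp: subblocks_def)
  have "G (Suc n) (0, 0)" using assms[of "Suc n"] n by (simp del: good.simps)
  from good_subblock_one_of_two[OF this in0] have "G n (2, 0) \<or> G n (2, 1)" by simp
  then obtain q where q: "q \<in> subblocks (0, 0)" "G n q" "fst q = 2"
    using in0 by (metis fst_conv)
  obtain c where c: "occ c" "fst c div 3 ^ n = fst q" "S c \<subseteq> R n q"
    using good_contains_cell[OF q(2)] by blast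
  have "n \<le> 3 ^ n" using less_exp[of n] power_mono[of 2 "3::nat" n] by simp
  moreover have "2 * 3 ^ n \<le> fst c"
    using c(2) q(3) by (metis div_times_less_eq_dividend)
  ultimately have "m \<le> fst c" using n by linarith
  moreover have "S c \<subseteq> R (Suc n) (0, 0)" using c(3) region_subblock[OF q(1,2)] by blast
  moreover have "Suc n \<ge> N" using n by simp
  ultimately show "\<exists>c. occ c \<and> fst c \<ge> m \<and> S c \<subseteq> ?U" using c(1) by blast
qed

end


section \<open>Percolation at high intensity\<close>

text \<open>Axial length \<open>L / 2\<close> keeps centres in neighbouring cells within
  \<open>L\<close> of each other. With unit spacing along \<open>f\<close>, a radius
  \<open>r < 1 / 2\<close> makes the columns disjoint and keeps perpendicular distances below
  \<open>2 * r + 1 \<le> 2\<close>.\<close>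

definition cell :: "'v::euclidean_space \<Rightarrow> 'v \<Rightarrow> real \<Rightarrow> real \<Rightarrow> nat \<times> nat \<Rightarrow> 'v set" where
  "cell e f L r c = cylinder e {real (fst c) * (L / 2)..<real (Suc (fst c)) * (L / 2)} (real (snd c) *\<^sub>R f) r"

lemma disjoint_cells:
  assumes "norm f = 1" and L: "L > 0" and r: "r < 1 / 2" and neq: "c \<noteq> c'"
  shows "cell e f L r c \<inter> cell e f L r c' = {}"
proof (rule ccontr)
  assume "cell e f L r c \<inter> cell e f L r c' \<noteq> {}"
  then obtain z where z: "z \<in> cell e f L r c" "z \<in> cell e f L r c'" by auto
  have "real (fst c) * (L / 2) < real (Suc (fst c')) * (L / 2)"
    "real (fst c') * (L / 2) < real (Suc (fst c)) * (L / 2)"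
    using z unfolding cell_def cylinder_def by auto
  then have "real (fst c) < real (Suc (fst c'))" "real (fst c') < real (Suc (fst c))"
    using L by (simp_all only: mult_less_cancel_right_pos[OF half_gt_zero[OF L]])
  then have fst: "fst c = fst c'" by simp
  have "norm (real (snd c) *\<^sub>R f - real (snd c') *\<^sub>R f)
      \<le> norm (perp e z - real (snd c') *\<^sub>R f) + norm (perp e z - real (snd c) *\<^sub>R f)"
    using norm_triangle_ineq4[of "perp e z - real (snd c') *\<^sub>R f" "perp e z - real (snd c) *\<^sub>R f"] by simp
  also have "\<dots> \<le> r + r"
    using z unfolding cell_def cylinder_def by auto
  also have "\<dots> < 1" using r by simp
  finally have "\<bar>real (snd c) - real (snd c')\<bar> < 1"
    using assms(1) by (simp flip: scaleR_diff_left)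
  then have "snd c = snd c'" by linarith
  with fst neq show False by (simp add: prod_eq_iff)
qed

context poisson_points
begin

text \<open>The assumption \<open>dense\<close> says that a cell contains at least 7 points on
  average, so it is vacant with probability at most \<open>exp (- 7)\<close>.\<close>

lemma AE_unbounded_connected:
  fixes e f :: 'v
  assumes e: "e \<in> Basis" and f: "f \<in> Basis" and ef: "e \<noteq> f" and L: "L > 0" and r: "0 < r" "r < 1 / 2"
    and dense: "lam * (L / 2 * (unit_ball_vol (real (DIM('v) - 1)) * r ^ (DIM('v) - 1))) \<ge> 7"
  shows "AE \<omega> in M. \<exists>U. connected U \<and> \<not> bounded U \<and> U \<subseteq> (\<Union>x\<in>Y \<omega>. stick L (x, e))"
proof -
  define v where "v = L / 2 * (unit_ball_vol (real (DIM('v) - 1)) * r ^ (DIM('v) - 1))"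
  let ?Q = "cell e f L r"
  have ne: "norm e = 1" and nf: "norm f = 1" using e f by auto
  have Q[measurable]: "?Q c \<in> sets borel" for c unfolding cell_def by measurable
  have emQ: "emeasure lborel (?Q c) = ennreal v" for c
  proof -
    have "emeasure lborel (?Q c) = ennreal (real (Suc (fst c)) * (L / 2) - real (fst c) * (L / 2)) *
        ennreal (unit_ball_vol (real (DIM('v) - 1)) * r ^ (DIM('v) - 1))"
      unfolding cell_def using e f ef r L
      by (subst emeasure_cylinder) (auto simp: inner_Basis mult_right_mono)
    also have "real (Suc (fst c)) * (L / 2) - real (fst c) * (L / 2) = L / 2"
      by (simp add: algebra_simps)
    finally show ?thesis using L by (simp add: v_def flip: ennreal_mult')
  qed
  have v: "v \<ge> 0" using L r by (simp add: v_def)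
  define V where "V F = {\<omega>\<in>space M. Y \<omega> \<inter> (\<Union>c\<in>F. ?Q c) = {}}" for F
  have prob_V: "prob (V F) = exp (- (lam * (real (card F) * v)))" if "finite F" for F
  proof -
    have dis: "disjoint_family_on ?Q F"
      using disjoint_cells[OF nf L r(2)] by (auto simp: disjoint_family_on_def)
    have "measure lborel (\<Union>c\<in>F. ?Q c) = (\<Sum>c\<in>F. measure lborel (?Q c))"
      using that dis by (intro measure_finite_Union) (auto simp: emQ)
    also have "\<dots> = real (card F) * v" using v by (simp add: measure_def emQ)
    finally have m: "measure lborel (\<Union>c\<in>F. ?Q c) = real (card F) * v" .
    have "emeasure lborel (\<Union>c\<in>F. ?Q c) \<le> (\<Sum>c\<in>F. emeasure lborel (?Q c))"
      using that by (intro emeasure_subadditive_finite) auto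
    also have "\<dots> < \<infinity>" by (simp add: emQ ennreal_mult_less_top of_nat_less_top)
    finally show ?thesis
      unfolding V_def using that by (subst prob_void) (auto simp: m)
  qed
  have V_event: "V F \<in> events" if "finite F" for F
    unfolding V_def using that by (intro void_event) auto
  define W where "W n = (\<Union>F\<in>witnesses n (0, 0). V F)" for n
  have fin: "finite F" "card F = 2 ^ n" if "F \<in> witnesses n (0, 0)" for F n
    using card_witness[OF that] by auto
  have W_event: "W n \<in> events" for n
    unfolding W_def using fin V_event by auto
  \<comment> \<open>81 is the growth base of the witness count. The Taylor polynomial
    \<open>1 + 1 + 1 / 2\<close> gives \<open>exp 1 \<ge> 5 / 2\<close>, and
    \<open>(5 / 2) ^ 7\<close> exceeds \<open>162 = 2 * 81\<close>.\<close>
  have exp7: "81 * exp (- 7 :: real) \<le> 1 / 2"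
  proof -
    have "(5 / 2 :: real) \<le> exp 1" using exp_lower_Taylor_quadratic[of 1] by simp
    then have "(5 / 2 :: real) ^ 7 \<le> exp 1 ^ 7" by (intro power_mono) auto
    also have "\<dots> = exp 7" by (simp flip: exp_of_nat_mult)
    finally have "162 \<le> exp (7::real)" by (simp add: power_numeral_reduce)
    then show ?thesis by (simp add: exp_minus field_simps)
  qed
  have prob_W: "prob (W n) \<le> (1 / 2) ^ n" for n
  proof -
    have "prob (W n) \<le> (\<Sum>F\<in>witnesses n (0, 0). prob (V F))"
      unfolding W_def using fin V_event by (intro finite_measure_subadditive_finite) auto
    also have "\<dots> = (\<Sum>F\<in>witnesses n (0, 0). exp (- (lam * (2 ^ n * v))))"
      using fin by (intro sum.cong) (auto simp: prob_V)
    \<comment> \<open>The exponent \<open>2 ^ n - 1\<close> is rounded up to match the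
      \<open>2 ^ n\<close> vacant cells of a witness.\<close>
    also have "\<dots> \<le> 81 ^ (2 ^ n) * exp (- (lam * (2 ^ n * v)))"
    proof -
      have "real (card (witnesses n (0, 0))) \<le> real (81 ^ (2 ^ n - 1))"
        using card_witnesses_le by (intro of_nat_mono)
      also have "\<dots> \<le> 81 ^ (2 ^ n)" by (simp add: power_increasing)
      finally show ?thesis by (simp add: mult_right_mono)
    qed
    also have "\<dots> \<le> 81 ^ (2 ^ n) * exp (- 7) ^ (2 ^ n)"
    proof -
      have "2 ^ n * 7 \<le> 2 ^ n * (lam * v)" using dense by (simp add: v_def)
      then have "exp (- (lam * (2 ^ n * v))) \<le> exp (real (2 ^ n) * - 7)" by (simp add: algebra_simps)
      also have "\<dots> = exp (- 7) ^ (2 ^ n)" by (rule exp_of_nat_mult)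
      finally show ?thesis by (intro mult_left_mono) auto
    qed
    also have "\<dots> = (81 * exp (- 7)) ^ (2 ^ n)" by (simp add: power_mult_distrib)
    also have "\<dots> \<le> (1 / 2) ^ (2 ^ n)" using exp7 by (intro power_mono) auto
    also have "\<dots> \<le> (1 / 2) ^ n" by (intro power_decreasing) (auto simp: less_imp_le)
    finally show ?thesis .
  qed
  have "AE \<omega> in M. eventually (\<lambda>n. \<omega> \<in> space M - W n) sequentially"
  proof (rule borel_cantelli_AE1)
    show "summable (\<lambda>n. prob (W n))"
      by (rule summable_comparison_test'[OF summable_geometric[of "1/2"], of 0]) (auto simp: prob_W)
  qed (use W_event in \<open>auto simp: emeasure_eq_measure\<close>)
  then show ?thesis
  proof eventually_elim
    case (elim \<omega>)
    \<comment> \<open>From here on the argument is deterministic: the outcome lies outside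
      \<open>W n\<close> for all \<open>n \<ge> N\<close>.\<close>
    then obtain N where N: "\<And>n. n \<ge> N \<Longrightarrow> \<omega> \<in> space M - W n"
      unfolding eventually_sequentially by blast
    define occ where "occ c \<longleftrightarrow> Y \<omega> \<inter> ?Q c \<noteq> {}" for c
    define S where "S c = (\<Union>x\<in>Y \<omega> \<inter> ?Q c. stick L (x, e))" for c
    \<comment> \<open>Covers at once two points of the same cell and of cells adjacent in either
      direction.\<close>
    have meet: "stick L (x, e) \<inter> stick L (y, e) \<noteq> {}"
      if x: "x \<in> ?Q (a, b)" and y: "y \<in> ?Q (a', b')"
        and a: "a' = a \<or> a' = Suc a" and b: "b' = b \<or> b' = Suc b" for x y a b a' b'
    proof (rule sticks_meet[OF ne])
      show "L \<ge> 0" using L by simp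
      show "\<bar>x \<bullet> e - y \<bullet> e\<bar> \<le> L"
        using x y a L unfolding cell_def cylinder_def by (auto simp: algebra_simps)
      have triangle: "norm (p - q) \<le> norm (p - a) + norm (q - c) + norm (a - c)" for p q a c :: 'v
        by norm
      have "norm (perp e x - perp e y) \<le> norm (perp e x - real b *\<^sub>R f)
          + norm (perp e y - real b' *\<^sub>R f) + norm (real b *\<^sub>R f - real b' *\<^sub>R f)"
        by (rule triangle)
      also have "\<dots> \<le> r + r + 1"
      proof (intro add_mono)
        show "norm (real b *\<^sub>R f - real b' *\<^sub>R f) \<le> 1"
          using b nf by (auto simp flip: scaleR_diff_left)
      qed (use x y in \<open>auto simp: cell_def cylinder_def\<close>)
      also have "\<dots> \<le> 2" using r by simp
      finally show "norm (perp e x - perp e y) \<le> 2" .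
    qed
    interpret occupied_cells occ S
    proof
      fix c assume "occ c"
      obtain a b where c: "c = (a, b)" by (cases c)
      show "connected (S c)"
        unfolding S_def
      proof (rule connected_UN_pairwise)
        fix x y assume "x \<in> Y \<omega> \<inter> ?Q c" "y \<in> Y \<omega> \<inter> ?Q c"
        then show "stick L (x, e) \<inter> stick L (y, e) \<noteq> {}"
          using meet[of x a b y a b] c by auto
      qed (use L in \<open>auto intro: connected_stick\<close>)
      show "S c \<noteq> {}"
        using \<open>occ c\<close> center_in_stick[of L _ e] L unfolding occ_def S_def by force
    next
      fix a b assume "occ (a, b)" "occ (Suc a, b)"
      then show "S (a, b) \<inter> S (Suc a, b) \<noteq> {}"
        using meet[of _ a b _ "Suc a" b] unfolding occ_def S_def by fast
    next
      fix a b assume "occ (a, b)" "occ (a, Suc b)"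
      then show "S (a, b) \<inter> S (a, Suc b) \<noteq> {}"
        using meet[of _ a b _ a "Suc b"] unfolding occ_def S_def by fast
    qed
    have "good occ n (0, 0)" if n: "n \<ge> N" for n
    proof (rule ccontr)
      assume "\<not> good occ n (0, 0)"
      then obtain F where F: "F \<in> witnesses n (0, 0)" "\<And>c. c \<in> F \<Longrightarrow> \<not> occ c"
        using not_good_witness[of occ n "(0, 0)"] by blast
      from F(2) have "Y \<omega> \<inter> (\<Union>c\<in>F. ?Q c) = {}" unfolding occ_def by blast
      then have "\<omega> \<in> W n" using F(1) N[OF n] unfolding W_def V_def by blast
      with N[OF n] show False by simp
    qed
    then obtain U where U: "connected U" "U \<subseteq> (\<Union>c\<in>{c. occ c}. S c)"
      "\<And>m::nat. \<exists>c. occ c \<and> fst c \<ge> m \<and> S c \<subseteq> U"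
      using eventually_good_connected_union by blast
    have "\<not> bounded U"
    proof
      assume "bounded U"
      then obtain B where B: "\<And>z. z \<in> U \<Longrightarrow> norm z \<le> B" by (auto simp: bounded_iff)
      obtain m :: nat where m: "B / (L / 2) < real m" using reals_Archimedean2 by blast
      obtain c where c: "occ c" "fst c \<ge> m" "S c \<subseteq> U" using U(3) by blast
      obtain x where x: "x \<in> Y \<omega>" "x \<in> ?Q c" using c(1) by (auto simp: occ_def)
      have "x \<in> U" using x c(3) center_in_stick[of L x e] L unfolding S_def by force
      have "B < real m * (L / 2)" using m L by (simp add: field_simps)
      also have "\<dots> \<le> real (fst c) * (L / 2)" using c(2) L by (intro mult_right_mono) auto
      also have "\<dots> \<le> x \<bullet> e" using x(2) by (auto simp: cell_def cylinder_def)
      also have "\<dots> \<le> norm x" using norm_cauchy_schwarz[of x e] ne by simp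
      also have "\<dots> \<le> B" using B \<open>x \<in> U\<close> by blast
      finally show False by simp
    qed
    with U(1,2) show ?case unfolding S_def by blast
  qed
qed

end


section \<open>Absence of percolation at low intensity\<close>

definition walks :: "'a::ab_group_add set \<Rightarrow> nat \<Rightarrow> 'a \<Rightarrow> 'a list set" where
  "walks N n g = {vs. length vs = Suc n \<and> hd vs = g \<and> successively (\<lambda>x y. y - x \<in> N) vs}"

lemma walks_0: "walks N 0 g = {[g]}"
  by (auto simp: walks_def length_Suc_conv)

lemma walks_Suc: "walks N (Suc n) g = (\<Union>m\<in>N. (#) g ` walks N n (g + m))"
proof (intro set_eqI iffI)
  fix vs assume "vs \<in> walks N (Suc n) g"
  then obtain y zs where vs: "vs = g # y # zs" "length zs = n" "y - g \<in> N"
    "successively (\<lambda>x y. y - x \<in> N) (y # zs)"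
    by (auto simp: walks_def length_Suc_conv)
  then have "y # zs \<in> walks N n (g + (y - g))" by (simp add: walks_def)
  with vs show "vs \<in> (\<Union>m\<in>N. (#) g ` walks N n (g + m))" by blast
next
  fix vs assume "vs \<in> (\<Union>m\<in>N. (#) g ` walks N n (g + m))"
  then obtain m ws where m: "m \<in> N" "vs = g # ws" "ws \<in> walks N n (g + m)" by auto
  then show "vs \<in> walks N (Suc n) g" by (cases ws) (auto simp: walks_def)
qed

lemma finite_walks: "finite N \<Longrightarrow> finite (walks N n g)"
  by (induction n arbitrary: g) (auto simp: walks_0 walks_Suc)

text \<open>Each of the \<open>n\<close> steps has \<open>card N\<close> choices. Walks that revisit
  vertices are counted too; self-avoidance enters later through \<open>distinct\<close>.\<close>

lemma card_walks_le: "finite N \<Longrightarrow> card (walks N n g) \<le> card N ^ n"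
proof (induction n arbitrary: g)
  case (Suc n)
  have "card (walks N (Suc n) g) \<le> (\<Sum>m\<in>N. card ((#) g ` walks N n (g + m)))"
    unfolding walks_Suc using Suc.prems by (rule card_UN_le)
  also have "\<dots> \<le> (\<Sum>m\<in>N. card N ^ n)"
  proof (rule sum_mono)
    fix m
    have "card ((#) g ` walks N n (g + m)) \<le> card (walks N n (g + m))"
      using Suc.prems by (intro card_image_le finite_walks)
    then show "card ((#) g ` walks N n (g + m)) \<le> card N ^ n"
      using Suc.IH[OF Suc.prems] by (rule order_trans)
  qed
  finally show ?case by simp
qed (simp add: walks_0)

text \<open>Loop erasure: if a new starting vertex already lies on the path, everything before its
  occurrence is cut off.\<close>

lemma rtranclp_distinct_path:
  assumes "E\<^sup>*\<^sup>* g h"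
  shows "\<exists>vs. vs \<noteq> [] \<and> hd vs = g \<and> last vs = h \<and> successively E vs \<and> distinct vs"
  using assms
proof (induction rule: converse_rtranclp_induct)
  case base
  show ?case by (rule exI[of _ "[h]"]) simp
next
  case (step g g')
  then obtain vs where vs: "vs \<noteq> []" "hd vs = g'" "last vs = h" "successively E vs" "distinct vs"
    by blast
  show ?case
  proof (cases "g \<in> set vs")
    case True
    then obtain ys zs where "vs = ys @ g # zs" by (meson split_list)
    with vs show ?thesis
      by (intro exI[of _ "g # zs"]) (auto simp: successively_append_iff)
  next
    case False
    with vs step(1) show ?thesis
      by (intro exI[of _ "g # vs"]) (auto simp: successively_Cons)
  qed
qed

text \<open>A repetition-free path with more than \<open>n\<close> steps would have a
  repetition-free initial part with exactly \<open>n\<close> steps. So every reachable vertex ends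
  one of finitely many walks.\<close>

lemma finite_reachable:
  fixes N :: "'a::ab_group_add set"
  assumes N: "finite N" and E: "\<And>x y. E x y \<Longrightarrow> y - x \<in> N"
    and bounded: "\<And>vs. length vs = Suc n \<Longrightarrow> hd vs = g \<Longrightarrow> successively E vs \<Longrightarrow> \<not> distinct vs"
  shows "finite {h. E\<^sup>*\<^sup>* g h}"
proof (rule finite_subset)
  show "finite (\<Union>m\<in>{..n}. last ` walks N m g)"
    using finite_walks[OF N] by auto
  show "{h. E\<^sup>*\<^sup>* g h} \<subseteq> (\<Union>m\<in>{..n}. last ` walks N m g)"
  proof
    fix h assume "h \<in> {h. E\<^sup>*\<^sup>* g h}"
    then obtain vs where vs: "vs \<noteq> []" "hd vs = g" "last vs = h" "successively E vs" "distinct vs"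
      using rtranclp_distinct_path[of E g h] by blast
    have "length vs \<le> Suc n"
    proof (rule ccontr)
      assume len: "\<not> length vs \<le> Suc n"
      have "successively E (take (Suc n) vs)"
        using vs(4) append_take_drop_id[of "Suc n" vs] by (metis successively_append_iff)
      then show False
        using bounded[of "take (Suc n) vs"] len vs by (simp add: hd_take)
    qed
    moreover have "successively (\<lambda>x y. y - x \<in> N) vs"
      using vs(4) by (rule successively_mono) (use E in auto)
    ultimately have "vs \<in> walks N (length vs - 1) g" "length vs - 1 \<le> n"
      using vs by (auto simp: walks_def)
    with vs(3) show "h \<in> (\<Union>m\<in>{..n}. last ` walks N m g)" by blast
  qed
qed

text \<open>A cube of side \<open>eps\<close> is named by its lower corner, so that no index type for the lattice is needed.\<close>

definition corner :: "real \<Rightarrow> 'v::euclidean_space \<Rightarrow> 'v" where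
  "corner eps x = (\<Sum>b\<in>Basis. (eps * of_int \<lfloor>(x \<bullet> b) / eps\<rfloor>) *\<^sub>R b)"

lemma inner_corner: "b \<in> Basis \<Longrightarrow> corner eps x \<bullet> b = eps * of_int \<lfloor>(x \<bullet> b) / eps\<rfloor>"
  by (simp add: corner_def)

lemma corner_le:
  assumes "eps > 0" "b \<in> Basis"
  shows "corner eps x \<bullet> b \<le> x \<bullet> b" "x \<bullet> b < corner eps x \<bullet> b + eps"
proof -
  let ?q = "(x \<bullet> b) / eps"
  have "eps * of_int \<lfloor>?q\<rfloor> \<le> eps * ?q" "eps * ?q < eps * (of_int \<lfloor>?q\<rfloor> + 1)"
    using assms(1) by (intro mult_left_mono mult_strict_left_mono; linarith)+
  moreover have "eps * ?q = x \<bullet> b" using assms(1) by simp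
  ultimately show "corner eps x \<bullet> b \<le> x \<bullet> b" "x \<bullet> b < corner eps x \<bullet> b + eps"
    unfolding inner_corner[OF assms(2)] by (simp_all only: distrib_left mult_1_right)
qed

lemma corner_eq_iff:
  assumes eps: "eps > 0"
  shows "corner eps x = corner eps y \<longleftrightarrow>
    (\<forall>b\<in>Basis. corner eps y \<bullet> b \<le> x \<bullet> b \<and> x \<bullet> b < corner eps y \<bullet> b + eps)" (is "?l \<longleftrightarrow> ?r")
proof
  assume ?l
  then show ?r using corner_le[OF eps, of _ x] by simp
next
  assume r: ?r
  show ?l
  proof (rule euclidean_eqI)
    fix b :: 'a assume b: "b \<in> Basis"
    have "\<lfloor>(x \<bullet> b) / eps\<rfloor> = \<lfloor>(y \<bullet> b) / eps\<rfloor>"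
      using bspec[OF r b] eps b by (intro floor_unique) (auto simp: inner_corner field_simps)
    then show "corner eps x \<bullet> b = corner eps y \<bullet> b" using b by (simp add: inner_corner)
  qed
qed

text \<open>The corners are closed under subtraction, so a step between two cubes is itself a corner
  and can belong to a fixed finite step set.\<close>

lemma corner_diff:
  assumes "eps > 0"
  shows "corner eps (corner eps x - corner eps y) = corner eps x - corner eps y"
proof (rule euclidean_eqI)
  fix b :: 'a assume b: "b \<in> Basis"
  have "(corner eps x - corner eps y) \<bullet> b =
      eps * of_int (\<lfloor>(x \<bullet> b) / eps\<rfloor> - \<lfloor>(y \<bullet> b) / eps\<rfloor>)"
    using b by (simp add: inner_diff_left inner_corner algebra_simps)
  then show "corner eps (corner eps x - corner eps y) \<bullet> b = (corner eps x - corner eps y) \<bullet> b"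
    using assms b by (simp only: inner_corner) simp
qed

lemma norm_diff_corner:
  assumes "eps > 0"
  shows "norm (x - corner eps (x::'v::euclidean_space)) \<le> real DIM('v) * eps"
proof -
  have "norm (x - corner eps x) \<le> (\<Sum>b\<in>Basis. \<bar>(x - corner eps x) \<bullet> b\<bar>)"
    by (rule norm_le_l1)
  also have "\<dots> \<le> (\<Sum>b\<in>(Basis::'v set). eps)"
    using corner_le[OF assms, of _ x] by (intro sum_mono) (force simp: inner_diff_left abs_le_iff)
  finally show ?thesis by simp
qed

lemma countable_range_corner: "countable (range (corner eps :: 'v::euclidean_space \<Rightarrow> 'v))"
proof (rule countable_subset)
  show "range (corner eps) \<subseteq> (\<lambda>k. \<Sum>b\<in>Basis. (eps * of_int (k b)) *\<^sub>R b) `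
      (PiE (Basis::'v set) (\<lambda>_. UNIV :: int set))"
  proof
    fix g assume "g \<in> range (corner eps :: 'v \<Rightarrow> 'v)"
    then obtain x where "g = corner eps x" by auto
    then show "g \<in> (\<lambda>k. \<Sum>b\<in>Basis. (eps * of_int (k b)) *\<^sub>R b) ` (PiE (Basis::'v set) (\<lambda>_. UNIV :: int set))"
      by (intro image_eqI[where x = "restrict (\<lambda>b. \<lfloor>(x \<bullet> b) / eps\<rfloor>) Basis"]) (auto simp: corner_def)
  qed
  show "countable ((\<lambda>k. \<Sum>b\<in>Basis. (eps * of_int (k b)) *\<^sub>R b) ` (PiE (Basis::'v set) (\<lambda>_. UNIV :: int set)))"
    by (intro countable_image countable_PiE) auto
qed

section \<open>Volumes of cubes and lattice points in a cylinder\<close>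

definition cube :: "real \<Rightarrow> 'v::euclidean_space \<Rightarrow> 'v set" where
  "cube eps g = {x. corner eps x = g}"

lemma cube_borel [measurable]: "cube eps g \<in> sets borel"
proof -
  have [measurable]: "corner eps \<in> borel_measurable borel" unfolding corner_def by measurable
  show ?thesis unfolding cube_def by measurable
qed

lemma disjoint_cubes: "g \<noteq> h \<Longrightarrow> cube eps g \<inter> cube eps h = {}"
  by (auto simp: cube_def)

lemma disjoint_family_cubes: "disjoint_family_on (cube eps) F"
  by (simp add: disjoint_family_on_def disjoint_cubes)

text \<open>The half-open cube lies between an open and a closed box of the same volume.\<close>

lemma emeasure_cube:
  fixes g :: "'v::euclidean_space"
  assumes eps: "eps > 0" and g: "g \<in> range (corner eps)"
  shows "emeasure lborel (cube eps g) = ennreal (eps ^ DIM('v))"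
proof (rule antisym)
  let ?h = "g + (\<Sum>b\<in>Basis. eps *\<^sub>R b)"
  have h: "?h \<bullet> b = g \<bullet> b + eps" if "b \<in> Basis" for b
    using that by (simp add: inner_add_left)
  obtain y where y: "g = corner eps y" using g by auto
  have cube: "cube eps g = {x. \<forall>b\<in>Basis. g \<bullet> b \<le> x \<bullet> b \<and> x \<bullet> b < g \<bullet> b + eps}"
    unfolding cube_def y corner_eq_iff[OF eps] ..
  have "emeasure lborel (cube eps g) \<le> emeasure lborel (cbox g ?h)"
    by (rule emeasure_mono) (auto simp: cube mem_box h less_imp_le)
  also have "\<dots> = ennreal (eps ^ DIM('v))"
    using eps by (subst emeasure_lborel_cbox) (auto simp: h inner_diff_left)
  finally show "emeasure lborel (cube eps g) \<le> ennreal (eps ^ DIM('v))" .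
  have "ennreal (eps ^ DIM('v)) = emeasure lborel (box g ?h)"
    using eps by (subst emeasure_lborel_box) (auto simp: h inner_diff_left)
  also have "\<dots> \<le> emeasure lborel (cube eps g)"
    by (rule emeasure_mono) (auto simp: cube mem_box h less_imp_le)
  finally show "ennreal (eps ^ DIM('v)) \<le> emeasure lborel (cube eps g)" .
qed

text \<open>Volume comparison: the disjoint cubes with these corners all fit into the cylinder
  enlarged by \<open>s\<close>, which bounds the distance of a point from its corner.\<close>

lemma lattice_points_in_cylinder:
  fixes e :: "'v::euclidean_space"
  assumes e: "e \<in> Basis" and eps: "eps > 0" and H: "H \<ge> 0" and \<rho>: "\<rho> \<ge> 0"
  defines "N \<equiv> {m \<in> range (corner eps). \<bar>m \<bullet> e\<bar> \<le> H \<and> norm (perp e m) \<le> \<rho>}"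
    and "s \<equiv> real DIM('v) * eps"
  shows "finite N" "real (card N) * eps ^ DIM('v) \<le>
    2 * (H + s) * (unit_ball_vol (real (DIM('v) - 1)) * (\<rho> + s) ^ (DIM('v) - 1))"
proof -
  let ?V = "2 * (H + s) * (unit_ball_vol (real (DIM('v) - 1)) * (\<rho> + s) ^ (DIM('v) - 1))"
  have s: "s > 0" using eps by (simp add: s_def)
  have ne: "norm e = 1" using e by auto
  have "e \<bullet> e = 1" using e by simp
  have V: "?V \<ge> 0" using s H \<rho> by (intro mult_nonneg_nonneg) auto
  let ?C = "cylinder e {- (H + s)..H + s} 0 (\<rho> + s)"
  have sub: "cube eps m \<subseteq> ?C" if "m \<in> N" for m
  proof
    fix x assume "x \<in> cube eps m"
    then have m: "m = corner eps x" by (simp add: cube_def)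
    have d: "norm (x - m) \<le> s" unfolding m s_def by (rule norm_diff_corner[OF eps])
    have "\<bar>(x - m) \<bullet> e\<bar> \<le> s" using Cauchy_Schwarz_ineq2[of "x - m" e] ne d by simp
    moreover have "\<bar>m \<bullet> e\<bar> \<le> H" using that by (simp add: N_def)
    ultimately have "\<bar>x \<bullet> e\<bar> \<le> H + s" by (simp add: inner_diff_left)
    moreover have "norm (perp e x) \<le> \<rho> + s"
    proof -
      have "norm (perp e x) \<le> norm (perp e m) + norm (perp e (x - m))"
        using norm_triangle_ineq[of "perp e m" "perp e (x - m)"] by (simp flip: perp_add)
      also have "\<dots> \<le> \<rho> + s"
        using that d norm_perp_le[OF ne, of "x - m"] by (intro add_mono) (auto simp: N_def)
      finally show ?thesis .
    qed
    ultimately show "x \<in> ?C" by (simp add: cylinder_def abs_le_iff)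
  qed
  have "emeasure lborel {- (H + s)..H + s} = ennreal (2 * (H + s))"
    using s H by (subst emeasure_lborel_Icc) (auto simp: algebra_simps simp del: ennreal_plus)
  moreover have "emeasure lborel ?C = emeasure lborel {- (H + s)..H + s} *
      ennreal (unit_ball_vol (real (DIM('v) - 1)) * (\<rho> + s) ^ (DIM('v) - 1))"
    by (rule emeasure_cylinder_0[OF e]) (use s \<rho> in auto)
  moreover have "ennreal (2 * (H + s)) * ennreal (unit_ball_vol (real (DIM('v) - 1)) * (\<rho> + s) ^ (DIM('v) - 1))
      = ennreal ?V"
    by (rule ennreal_mult[symmetric]) (use s H \<rho> in auto)
  ultimately have emC: "emeasure lborel ?C = ennreal ?V" by (simp only:)
  have bound: "real (card F) * eps ^ DIM('v) \<le> ?V" if F: "finite F" "F \<subseteq> N" for F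
  proof -
    have emq: "emeasure lborel (cube eps m) = ennreal (eps ^ DIM('v))" if "m \<in> F" for m
      using that F by (intro emeasure_cube[OF eps]) (auto simp: N_def)
    have "ennreal (real (card F) * eps ^ DIM('v)) = (\<Sum>m\<in>F. emeasure lborel (cube eps m))"
      using emq eps by (simp add: ennreal_mult ennreal_of_nat_eq_real_of_nat)
    also have "\<dots> = emeasure lborel (\<Union>m\<in>F. cube eps m)"
      using F(1) by (intro sum_emeasure) (auto intro: cube_borel disjoint_family_cubes)
    also have "\<dots> \<le> ennreal ?V"
      unfolding emC[symmetric] using sub F by (intro emeasure_mono) auto
    finally show ?thesis using V by (simp add: ennreal_le_iff)
  qed
  \<comment> \<open>The bound already holds for every finite subset, which excludes an infinite
    \<open>N\<close>.\<close>
  show fin: "finite N"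
  proof (rule ccontr)
    assume "infinite N"
    obtain k :: nat where k: "?V / eps ^ DIM('v) < real k" using reals_Archimedean2 by blast
    obtain F where F: "F \<subseteq> N" "finite F" "card F = k"
      using infinite_arbitrarily_large[OF \<open>infinite N\<close>] by blast
    have "real k * eps ^ DIM('v) \<le> ?V" using bound F by blast
    with k eps show False by (simp add: pos_divide_less_eq)
  qed
  show "real (card N) * eps ^ DIM('v) \<le> ?V" by (rule bound[OF fin order_refl])
qed

text \<open>Balls of half the gap around \<open>A\<close> and \<open>B\<close> give disjoint open
  sets. A uniform gap stands in for closedness, which is not immediate for a union of infinitely
  many sticks.\<close>

lemma connected_separated_subset:
  fixes K A B :: "'a::metric_space set"
  assumes K: "connected K" "K \<subseteq> A \<union> B" "K \<inter> A \<noteq> {}" and \<delta>: "\<delta> > 0"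
    and sep: "\<And>u v. u \<in> A \<Longrightarrow> v \<in> B \<Longrightarrow> dist u v \<ge> \<delta>"
  shows "K \<subseteq> A"
proof -
  let ?U = "\<Union>a\<in>A. ball a (\<delta> / 2)" and ?V = "\<Union>b\<in>B. ball b (\<delta> / 2)"
  have sub: "A \<subseteq> ?U" "B \<subseteq> ?V" using \<delta> by auto
  have "?U \<inter> ?V = {}"
  proof (rule ccontr)
    assume "?U \<inter> ?V \<noteq> {}"
    then obtain a b z where z: "a \<in> A" "b \<in> B" "dist a z < \<delta> / 2" "dist b z < \<delta> / 2" by auto
    then have "dist a b < \<delta>" using dist_triangle_half_l[of a z \<delta> b] by (simp add: dist_commute)
    with sep[OF z(1,2)] show False by simp
  qed
  then have "?U \<inter> K = {} \<or> ?V \<inter> K = {}"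
    using K sub by (intro connectedD) auto
  then have "?V \<inter> K = {}" using K(3) sub by blast
  then show ?thesis using K(2) sub by blast
qed

section \<open>Occupied paths and bounded clusters\<close>

context poisson_points
begin

text \<open>Distinct cubes are disjoint, hence independently occupied, and
  \<open>1 - exp (- x) \<le> x\<close>.\<close>

lemma prob_cubes_occupied_le:
  assumes eps: "eps > 0" and vs: "distinct vs" "set vs \<subseteq> range (corner eps)"
  shows "prob {\<omega>\<in>space M. \<forall>v\<in>set vs. Y \<omega> \<inter> cube eps v \<noteq> {}} \<le> (lam * eps ^ DIM('v)) ^ length vs"
    (is "prob ?A \<le> _")
proof -
  let ?q = "\<lambda>i. cube eps (vs ! i)"
  have em: "emeasure lborel (?q i) = ennreal (eps ^ DIM('v))" if "i < length vs" for i
    using that vs by (intro emeasure_cube[OF eps]) (auto dest: nth_mem)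
  have "?A = {\<omega>\<in>space M. \<forall>i<length vs. Y \<omega> \<inter> ?q i \<noteq> {}}"
    by (auto simp: all_set_conv_all_nth)
  also have "prob \<dots> = (\<Prod>i<length vs. 1 - exp (- (lam * measure lborel (?q i))))"
    using vs em by (intro prob_all_occupied)
      (auto simp: disjoint_family_on_def nth_eq_iff_index_eq intro!: disjoint_cubes)
  also have "\<dots> \<le> (\<Prod>i<length vs. lam * eps ^ DIM('v))"
  proof (rule prod_mono)
    fix i assume "i \<in> {..<length vs}"
    then have m: "measure lborel (?q i) = eps ^ DIM('v)"
      using em eps by (simp add: measure_def)
    have "0 \<le> lam * eps ^ DIM('v)" using lam_pos eps by simp
    then show "0 \<le> 1 - exp (- (lam * measure lborel (?q i))) \<and>
        1 - exp (- (lam * measure lborel (?q i))) \<le> lam * eps ^ DIM('v)"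
      using exp_ge_add_one_self[of "- (lam * eps ^ DIM('v))"] unfolding m by simp
  qed
  finally show ?thesis by simp
qed

text \<open>At most \<open>card N ^ n\<close> walks of \<open>n\<close> steps, each self-avoiding
  one occupied with probability at most \<open>?p ^ Suc n\<close>, give a geometric series of ratio
  \<open>card N * ?p < 1\<close>; Borel-Cantelli applies.\<close>

lemma AE_no_long_occupied_path:
  fixes N :: "'v set"
  assumes eps: "eps > 0" and N: "finite N" and sub: "lam * (real (card N) * eps ^ DIM('v)) < 1"
  shows "AE \<omega> in M. \<forall>g\<in>range (corner eps). \<exists>n\<ge>1. \<forall>vs\<in>walks N n g.
    (\<forall>v\<in>set vs. Y \<omega> \<inter> cube eps v \<noteq> {}) \<longrightarrow> \<not> distinct vs"
\<comment> \<open>The lattice is countable, so the starting cube may be fixed first.\<close>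
proof (subst AE_ball_countable[OF countable_range_corner], intro ballI)
  fix g :: 'v assume "g \<in> range (corner eps)"
  let ?p = "lam * eps ^ DIM('v)" and ?P = "\<lambda>n. {vs \<in> walks N n g. distinct vs \<and> set vs \<subseteq> range (corner eps)}"
  let ?A = "\<lambda>vs. {\<omega>\<in>space M. \<forall>v\<in>set vs. Y \<omega> \<inter> cube eps v \<noteq> {}}"
  define B where "B n = (\<Union>vs\<in>?P n. ?A vs)" for n
  have A_event: "?A vs \<in> events" for vs
    using occupied_event[OF cube_borel] by (intro sets.sets_Collect_finite_All) auto
  have p: "?p \<ge> 0" using lam_pos eps by simp
  have fin: "finite (?P n)" for n using finite_walks[OF N] by auto
  have B_event: "B n \<in> events" for n
    unfolding B_def using fin A_event by auto
  have prob_B: "prob (B n) \<le> ?p * (real (card N) * ?p) ^ n" for n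
  proof -
    have "prob (B n) \<le> (\<Sum>vs\<in>?P n. prob (?A vs))"
      unfolding B_def using fin A_event by (intro finite_measure_subadditive_finite) auto
    also have "\<dots> \<le> (\<Sum>vs\<in>?P n. ?p ^ Suc n)"
    proof (rule sum_mono)
      fix vs assume vs: "vs \<in> ?P n"
      then have "length vs = Suc n" by (auto simp: walks_def)
      with vs prob_cubes_occupied_le[OF eps, of vs] show "prob (?A vs) \<le> ?p ^ Suc n" by auto
    qed
    also have "\<dots> = real (card (?P n)) * ?p ^ Suc n" by simp
    also have "\<dots> \<le> real (card N ^ n) * ?p ^ Suc n"
    proof (intro mult_right_mono of_nat_mono)
      have "card (?P n) \<le> card (walks N n g)" using finite_walks[OF N] by (intro card_mono) auto
      also have "\<dots> \<le> card N ^ n" by (rule card_walks_le[OF N])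
      finally show "card (?P n) \<le> card N ^ n" .
    qed (use p in simp)
    also have "\<dots> = ?p * (real (card N) * ?p) ^ n" by (simp add: power_mult_distrib)
    finally show ?thesis .
  qed
  have "AE \<omega> in M. eventually (\<lambda>n. \<omega> \<in> space M - B n) sequentially"
  proof (rule borel_cantelli_AE1)
    have "real (card N) * ?p \<ge> 0" using p by simp
    moreover have "real (card N) * ?p < 1" using sub by (simp only: mult.left_commute)
    ultimately have "summable (\<lambda>n. ?p * (real (card N) * ?p) ^ n)"
      by (intro summable_mult summable_geometric) (simp only: real_norm_def abs_of_nonneg)
    then show "summable (\<lambda>n. prob (B n))"
      by (rule summable_comparison_test') (auto intro: prob_B)
  qed (use B_event in \<open>auto simp: emeasure_eq_measure\<close>)
  then show "AE \<omega> in M. \<exists>n\<ge>1. \<forall>vs\<in>walks N n g.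
      (\<forall>v\<in>set vs. Y \<omega> \<inter> cube eps v \<noteq> {}) \<longrightarrow> \<not> distinct vs"
  proof eventually_elim
    case (elim \<omega>)
    then obtain n0 where n0: "\<And>n. n \<ge> n0 \<Longrightarrow> \<omega> \<in> space M - B n"
      unfolding eventually_sequentially by blast
    \<comment> \<open>At least one step is required because occupation of the starting cube is later
      read off from an edge.\<close>
    let ?n = "max 1 n0"
    have "\<not> distinct vs" if vs: "vs \<in> walks N ?n g" "\<forall>v\<in>set vs. Y \<omega> \<inter> cube eps v \<noteq> {}" for vs
    proof
      assume "distinct vs"
      \<comment> \<open>An occupied cube is nonempty, so its name is a genuine corner.\<close>
      moreover have "set vs \<subseteq> range (corner eps)" using vs(2) by (auto simp: cube_def)
      ultimately have "\<omega> \<in> B ?n" using vs n0[of ?n] by (auto simp: B_def)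
      then show False using n0[of ?n] by auto
    qed
    then show ?case by (intro exI[of _ ?n]) auto
  qed
qed

lemma AE_not_percolates:
  fixes e :: 'v
  assumes e: "e \<in> Basis" and L: "L > 0" and t: "t > 0"
    and sub: "lam * (2 * (L + 2 + t) * (unit_ball_vol (real (DIM('v) - 1)) * (2 + t) ^ (DIM('v) - 1))) < 1"
  shows "AE \<omega> in M. \<not> percolates (\<Union>x\<in>Y \<omega>. stick L (x, e))"
proof -
  txt \<open>The slack \<open>t\<close> absorbs the diameters of three cubes and the gap \<open>s\<close> between clusters.\<close>
  define s where "s = t / 4"
  define eps where "eps = s / real DIM('v)"
  define N where "N = {m \<in> range (corner eps). \<bar>m \<bullet> e\<bar> \<le> L + 2 + 3 * s \<and> norm (perp e m) \<le> 2 + 3 * s}"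
  have s: "s > 0" using t by (simp add: s_def)
  have eps: "eps > 0" using s by (simp add: eps_def)
  have s_eq: "real DIM('v) * eps = s" by (simp add: eps_def)
  have ne: "norm e = 1" using e by auto
  have N: "finite N"
    unfolding N_def by (rule lattice_points_in_cylinder[OF e eps]) (use L s in auto)
  have "real (card N) * eps ^ DIM('v) \<le> 2 * (L + 2 + 3 * s + s) *
      (unit_ball_vol (real (DIM('v) - 1)) * (2 + 3 * s + s) ^ (DIM('v) - 1))"
    unfolding N_def s_eq[symmetric]
    by (rule lattice_points_in_cylinder[OF e eps]) (use L s in \<open>auto simp: s_eq\<close>)
  also have "\<dots> = 2 * (L + 2 + t) * (unit_ball_vol (real (DIM('v) - 1)) * (2 + t) ^ (DIM('v) - 1))"
  proof -
    have "L + 2 + 3 * s + s = L + 2 + t" "2 + 3 * s + s = 2 + t" by (simp_all add: s_def)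
    then show ?thesis by (simp only:)
  qed
  finally have "lam * (real (card N) * eps ^ DIM('v)) < 1"
    using lam_pos sub by (meson le_less_trans less_imp_le mult_left_mono)
  from AE_no_long_occupied_path[OF eps N this] show ?thesis
  proof eventually_elim
    case (elim \<omega>)
    define E where "E g h \<longleftrightarrow> Y \<omega> \<inter> cube eps g \<noteq> {} \<and> Y \<omega> \<inter> cube eps h \<noteq> {} \<and> h - g \<in> N" for g h
    have finE: "finite {h. E\<^sup>*\<^sup>* g h}" if g: "g \<in> range (corner eps)" for g
    proof -
      obtain n where n: "n \<ge> 1" "\<And>vs. vs \<in> walks N n g \<Longrightarrow>
          (\<forall>v\<in>set vs. Y \<omega> \<inter> cube eps v \<noteq> {}) \<Longrightarrow> \<not> distinct vs"
        using bspec[OF elim g] by blast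
      show ?thesis
      proof (rule finite_reachable[OF N, of E n g])
        fix vs assume vs: "length vs = Suc n" "hd vs = g" "successively E vs"
        have "successively (\<lambda>x y. y - x \<in> N) vs"
          using vs(3) by (rule successively_mono) (auto simp: E_def)
        moreover have "Y \<omega> \<inter> cube eps v \<noteq> {}" if v: "v \<in> set vs" for v
        proof -
          obtain i where i: "i < length vs" "v = vs ! i" using v by (auto simp: in_set_conv_nth)
          have nth: "E (vs ! j) (vs ! Suc j)" if "Suc j < length vs" for j
            using successively_nth[OF vs(3) that] .
          show ?thesis
          proof (cases i)
            case 0
            then show ?thesis using nth[of 0] vs(1) n(1) i by (auto simp: E_def)
          next
            case (Suc j)
            then show ?thesis using nth[of j] i by (auto simp: E_def)
          qed
        qed
        ultimately show "\<not> distinct vs" using n(2)[of vs] vs by (auto simp: walks_def)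
      qed (auto simp: E_def)
    qed
    \<comment> \<open>Replacing the two centres by corners costs \<open>s\<close> each, and the gap
      between the sticks another \<open>s\<close>, on top of \<open>L + 2\<close> and 2.\<close>
    have close: "E (corner eps x) (corner eps y)"
      if x: "x \<in> Y \<omega>" "u \<in> stick L (x, e)" and y: "y \<in> Y \<omega>" "v \<in> stick L (y, e)" and uv: "dist u v < s"
      for x y u v
    proof -
      have L0: "L \<ge> 0" using L by simp
      let ?cx = "corner eps x" and ?cy = "corner eps y"
      have cx: "norm (x - ?cx) \<le> s" and cy: "norm (y - ?cy) \<le> s"
        using norm_diff_corner[OF eps, of x] norm_diff_corner[OF eps, of y] by (simp_all add: s_eq)
      have uv': "norm (u - v) \<le> s" using uv by (simp add: dist_norm)
      have ax: "\<bar>w \<bullet> e\<bar> \<le> norm w" for w using Cauchy_Schwarz_ineq2[of w e] ne by simp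
      have "\<bar>(?cy - ?cx) \<bullet> e\<bar> \<le> L + 2 + 3 * s"
        using stick_offset(1)[OF ne L0 x(2)] stick_offset(1)[OF ne L0 y(2)]
          order_trans[OF ax cx] order_trans[OF ax cy] order_trans[OF ax uv']
        unfolding inner_diff_left by linarith
      moreover have "norm (perp e (?cy - ?cx)) \<le> 2 + 3 * s"
      proof -
        have small: "norm (perp e (x - ?cx)) \<le> s" "norm (perp e (y - ?cy)) \<le> s" "norm (perp e (u - v)) \<le> s"
          using cx cy uv' norm_perp_le[OF ne] order_trans by blast+
        have "perp e (?cy - ?cx) = perp e (x - ?cx) - perp e (y - ?cy)
            + (perp e u - perp e x) - (perp e v - perp e y) - perp e (u - v)"
          by (simp add: perp_diff)
        moreover have "norm (a - b + c - d - f) \<le> norm a + norm b + norm c + norm d + norm f"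
          for a b c d f :: 'v by norm
        ultimately have "norm (perp e (?cy - ?cx)) \<le> norm (perp e (x - ?cx)) + norm (perp e (y - ?cy))
            + norm (perp e u - perp e x) + norm (perp e v - perp e y) + norm (perp e (u - v))"
          by (simp only:)
        also have "\<dots> \<le> s + s + 1 + 1 + s"
          by (intro add_mono) (use stick_offset(2)[OF ne L0 x(2)] stick_offset(2)[OF ne L0 y(2)] small in auto)
        finally show ?thesis by simp
      qed
      moreover have "?cy - ?cx \<in> range (corner eps)"
        using corner_diff[OF eps, of y x] by (metis rangeI)
      ultimately show ?thesis using x(1) y(1) by (auto simp: E_def N_def cube_def)
    qed
    show ?case
      unfolding percolates_def
    proof clarify
      fix K assume K: "K \<in> components (\<Union>x\<in>Y \<omega>. stick L (x, e))" and unb: "\<not> bounded K"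
      have Ksub: "K \<subseteq> (\<Union>x\<in>Y \<omega>. stick L (x, e))" and Kcon: "connected K" and "K \<noteq> {}"
        using in_components_subset[OF K] in_components_connected[OF K] in_components_nonempty[OF K] by auto
      then obtain z x0 where z: "z \<in> K" "x0 \<in> Y \<omega>" "z \<in> stick L (x0, e)" by blast
      \<comment> \<open>The cluster of cubes reached from \<open>x0\<close>. Sticks centred in it
        and all other sticks are at distance at least \<open>s\<close> by \<open>close\<close>, so
        \<open>K\<close> stays with the former.\<close>
      define Z where "Z = {h. E\<^sup>*\<^sup>* (corner eps x0) h}"
      have finZ: "finite Z" unfolding Z_def by (rule finE) simp
      let ?A = "\<Union>x\<in>{x \<in> Y \<omega>. corner eps x \<in> Z}. stick L (x, e)"
      let ?B = "\<Union>x\<in>{x \<in> Y \<omega>. corner eps x \<notin> Z}. stick L (x, e)"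
      have KA: "K \<subseteq> ?A"
      proof (rule connected_separated_subset[OF Kcon _ _ s])
        show "K \<subseteq> ?A \<union> ?B" using Ksub by blast
        have "corner eps x0 \<in> Z" by (simp add: Z_def)
        then show "K \<inter> ?A \<noteq> {}" using z by blast
        fix u v assume "u \<in> ?A" "v \<in> ?B"
        then obtain x y where x: "x \<in> Y \<omega>" "corner eps x \<in> Z" "u \<in> stick L (x, e)"
          and y: "y \<in> Y \<omega>" "corner eps y \<notin> Z" "v \<in> stick L (y, e)" by auto
        show "s \<le> dist u v"
        proof (rule ccontr)
          assume "\<not> s \<le> dist u v"
          then have "E (corner eps x) (corner eps y)" using close x y by simp
          with x(2) y(2) show False by (simp add: Z_def rtranclp.rtrancl_into_rtrancl)
        qed
      qed
      \<comment> \<open>Enclosing each stick in a ball about the corner of its cube bounds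
        \<open>?A\<close>, however many points a cube holds.\<close>
      have A_sub: "?A \<subseteq> (\<Union>h\<in>Z. cball h (s + L / 2 + 1))"
      proof
        fix u assume "u \<in> ?A"
        then obtain x where x: "corner eps x \<in> Z" "u \<in> stick L (x, e)" by auto
        obtain \<tau> where \<tau>: "\<bar>\<tau>\<bar> \<le> L / 2" "dist u (x + \<tau> *\<^sub>R e) \<le> 1"
          using x(2) L by (auto simp: mem_stick_iff)
        have "dist x (corner eps x) \<le> s"
          using norm_diff_corner[OF eps, of x] by (simp add: s_eq dist_norm)
        moreover have "dist (x + \<tau> *\<^sub>R e) x \<le> L / 2" using \<tau>(1) ne by (simp add: dist_norm)
        ultimately have "dist u (corner eps x) \<le> s + L / 2 + 1"
          using \<tau>(2) dist_triangle[of u "corner eps x" "x + \<tau> *\<^sub>R e"]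
            dist_triangle[of "x + \<tau> *\<^sub>R e" "corner eps x" x] by linarith
        then show "u \<in> (\<Union>h\<in>Z. cball h (s + L / 2 + 1))"
          using x(1) by (auto simp: dist_commute)
      qed
      have "bounded (\<Union>h\<in>Z. cball h (s + L / 2 + 1))"
        using finZ by (intro bounded_UN) auto
      then have "bounded K" by (rule bounded_subset[OF _ order_trans[OF KA A_sub]])
      with unb show False ..
    qed
  qed
qed

end


section \<open>The critical intensity\<close>

lemma unit_ball_vol_pred:
  assumes "d \<ge> 1"
  shows "unit_ball_vol (real (d - 1)) = pi powr ((real d - 1) / 2) / Gamma ((real d + 1) / 2)"
  using assms by (simp add: unit_ball_vol_def of_nat_diff field_simps)

lemma stick_union_rigid:
  assumes "\<forall>(x, p)\<in>Z. p = e"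
  shows "stick_union L Z = (\<Union>x\<in>{x. (x, e) \<in> Z}. stick L (x, e))"
proof (intro equalityI subsetI)
  fix y assume "y \<in> stick_union L Z"
  then obtain x p where "(x, p) \<in> Z" "y \<in> stick L (x, p)" unfolding stick_union_def by auto
  moreover from this have "p = e" using assms by auto
  ultimately show "y \<in> (\<Union>x\<in>{x. (x, e) \<in> Z}. stick L (x, e))" by blast
next
  fix y assume "y \<in> (\<Union>x\<in>{x. (x, e) \<in> Z}. stick L (x, e))"
  then show "y \<in> stick_union L Z" unfolding stick_union_def by blast
qed

text \<open>A connected subset lies within a single component, which inherits its
  unboundedness.\<close>

lemma percolates_mono_connected:
  assumes "connected U" "\<not> bounded U" "U \<subseteq> C"
  shows "percolates C"
proof -
  have "U \<noteq> {}" using assms by auto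
  then obtain x where x: "x \<in> U" by auto
  have "U \<subseteq> connected_component_set C x"
    using assms x by (intro connected_component_maximal)
  moreover have "connected_component_set C x \<in> components C"
    using assms x by (intro componentsI) auto
  ultimately show ?thesis
    using assms bounded_subset unfolding percolates_def by blast
qed

context
  fixes e :: "'v::euclidean_space" and M :: "real \<Rightarrow> 'w measure" and X
  assumes e: "e \<in> Basis" and dim: "DIM('v) \<ge> 2"
    and model: "poisson_stick_model (rigid_orientation e) M X"
begin

text \<open>Below the bound, \<open>lam * (L * w * 2 ^ d)\<close> is less than
  \<open>1 / sqrt pi < 3 / 5\<close>, where \<open>d\<close> is the dimension. As
  \<open>L > 3\<close> gives \<open>L + 2 \<le> 5 / 3 * L\<close>, the mean number of centres in the
  interaction cylinder is below 1, and percolation almost surely fails.\<close>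

lemma critical_intensity_ge:
  assumes L: "L > 3"
  shows "critical_intensity M X L \<ge> ereal (Gamma ((real DIM('v) + 1) / 2)
    / (2 ^ DIM('v) * pi powr (real DIM('v) / 2)) * inverse L)"
  unfolding critical_intensity_def
proof (rule Inf_greatest, clarify)
  fix lam assume lam: "lam > 0" and perc: "AE \<omega> in M lam. percolates (stick_union L (X lam \<omega>))"
  let ?d = "DIM('v)" and ?b = "Gamma ((real DIM('v) + 1) / 2) / (2 ^ DIM('v) * pi powr (real DIM('v) / 2)) * inverse L"
  define w where "w = unit_ball_vol (real (?d - 1))"
  have ne: "norm e = 1" using e by auto
  interpret poisson_points "M lam" "\<lambda>\<omega>. {x. (x, e) \<in> X lam \<omega>}" lam
    by (rule poisson_stick_model_rigid[OF ne lam model])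
  have w: "w > 0" by (simp add: w_def)
  have G: "Gamma ((real ?d + 1) / 2) > 0" by (intro Gamma_real_pos) simp
  have w_Gamma: "w * Gamma ((real ?d + 1) / 2) = pi powr ((real ?d - 1) / 2)"
    using less_imp_neq[OF G, symmetric] dim unfolding w_def by (subst unit_ball_vol_pred) auto
  show "ereal ?b \<le> ereal lam"
  proof (rule ccontr)
    assume "\<not> ereal ?b \<le> ereal lam"
    then have "lam < ?b" by simp
    then have "lam * (L * w * 2 ^ ?d) < ?b * (L * w * 2 ^ ?d)"
      using L w by (intro mult_strict_right_mono) auto
    also have "\<dots> = pi powr ((real ?d - 1) / 2) / pi powr (real ?d / 2)"
    proof -
      have "g / (c * P) * inverse L * (L * w * c) = w * g / P" if "c \<noteq> 0" "P \<noteq> 0" for g c P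
        using that L by (simp add: field_simps)
      then show ?thesis unfolding w_Gamma[symmetric] by this simp_all
    qed
    also have "\<dots> = pi powr (- (1 / 2))"
    proof -
      have "(real ?d - 1) / 2 - real ?d / 2 = - (1 / 2)" by (simp add: field_simps)
      then show ?thesis by (simp only: powr_diff[symmetric])
    qed
    also have "\<dots> = 1 / sqrt pi"
      by (simp only: powr_minus powr_half_sqrt pi_ge_zero inverse_eq_divide)
    also have "\<dots> < 3 / 5"
    proof -
      have "(5 / 3)\<^sup>2 < pi" using pi_gt3 by (simp add: power2_eq_square)
      then have "5 / 3 < sqrt pi" by (rule real_less_rsqrt)
      then show ?thesis by (simp add: field_simps)
    qed
    finally have lamL: "lam * (L * w * 2 ^ ?d) < 3 / 5" .
    \<comment> \<open>The inequality is strict at \<open>t = 0\<close>, so by continuity it persists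
      for some positive slack \<open>t\<close>.\<close>
    have "((\<lambda>t. lam * (2 * (L + 2 + t) * (w * (2 + t) ^ (?d - 1)))) \<longlongrightarrow>
        lam * (2 * (L + 2 + 0) * (w * (2 + 0) ^ (?d - 1)))) (at_right 0)"
      by (intro tendsto_intros)
    moreover have "lam * (2 * (L + 2 + 0) * (w * (2 + 0) ^ (?d - 1))) < 1"
    proof -
      have pow: "(2::real) ^ ?d = 2 ^ (?d - 1) * 2" by (rule power_minus_mult[symmetric]) simp
      have "lam * (2 * (L + 2 + 0) * (w * (2 + 0) ^ (?d - 1))) = lam * ((L + 2) * w * 2 ^ ?d)"
        unfolding pow by (simp add: algebra_simps)
      also have "\<dots> \<le> lam * ((5 / 3 * L) * w * 2 ^ ?d)"
        using lam w L by (intro mult_left_mono mult_right_mono) auto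
      also have "\<dots> = 5 / 3 * (lam * (L * w * 2 ^ ?d))" by simp
      also have "\<dots> < 1" using lamL by simp
      finally show ?thesis .
    qed
    ultimately have "eventually (\<lambda>t. lam * (2 * (L + 2 + t) * (w * (2 + t) ^ (?d - 1))) < 1) (at_right 0)"
      by (rule order_tendstoD(2))
    with eventually_at_right_less[of "0::real"]
    have "eventually (\<lambda>t::real. t > 0 \<and> lam * (2 * (L + 2 + t) * (w * (2 + t) ^ (?d - 1))) < 1) (at_right 0)"
      by (rule eventually_conj)
    then obtain t where t: "t > 0" "lam * (2 * (L + 2 + t) * (w * (2 + t) ^ (?d - 1))) < 1"
      using eventually_happens[of _ "at_right (0::real)"] by auto
    have "AE \<omega> in M lam. \<not> percolates (\<Union>x\<in>{x. (x, e) \<in> X lam \<omega>}. stick L (x, e))"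
      by (rule AE_not_percolates[OF e _ t(1)]) (use L t(2) in \<open>auto simp: w_def\<close>)
    with perc poisson_stick_model_rigid(2)[OF ne lam model] have "AE \<omega> in M lam. False"
    proof eventually_elim
      case (elim \<omega>)
      then show False using stick_union_rigid[of "X lam \<omega>" e L] by simp
    qed
    then show False by simp
  qed
qed

text \<open>The bound itself is an intensity with percolation: a cell of radius \<open>1 / 2\<close>
  would contain \<open>4 * sqrt pi > 7\<close> points on average.\<close>

lemma critical_intensity_le:
  assumes L: "L > 0"
  shows "critical_intensity M X L \<le> ereal (4 * (2 ^ DIM('v) * Gamma ((real DIM('v) + 1) / 2)
    / pi powr (real DIM('v) / 2 - 1)) * inverse L)"
  unfolding critical_intensity_def
proof (rule Inf_lower, clarify, intro exI conjI, rule refl)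
  let ?d = "DIM('v)"
  define lam where "lam = 4 * (2 ^ ?d * Gamma ((real ?d + 1) / 2) / pi powr (real ?d / 2 - 1)) * inverse L"
  define w where "w = unit_ball_vol (real (?d - 1))"
  have ne: "norm e = 1" using e by auto
  have w: "w > 0" by (simp add: w_def)
  have G: "Gamma ((real ?d + 1) / 2) > 0" by (intro Gamma_real_pos) simp
  have w_Gamma: "w * Gamma ((real ?d + 1) / 2) = pi powr ((real ?d - 1) / 2)"
    using less_imp_neq[OF G, symmetric] dim unfolding w_def by (subst unit_ball_vol_pred) auto
  have lam: "lam > 0" using G L by (simp add: lam_def)
  interpret poisson_points "M lam" "\<lambda>\<omega>. {x. (x, e) \<in> X lam \<omega>}" lam
    by (rule poisson_stick_model_rigid[OF ne lam model])
  \<comment> \<open>Dimension at least 2 supplies the second direction of the grid.\<close>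
  obtain f where f: "f \<in> Basis" "e \<noteq> f"
  proof -
    have "card (Basis :: 'v set) \<noteq> card {e}" using dim by simp
    then have "Basis \<noteq> {e}" by metis
    then show ?thesis using e that by blast
  qed
  \<comment> \<open>Closed cells of radius exactly \<open>1 / 2\<close> could touch; the strict
    inequality at \<open>1 / 2\<close> leaves room for a slightly smaller \<open>r\<close>.\<close>
  have "((\<lambda>r. lam * (L / 2 * (w * r ^ (?d - 1)))) \<longlongrightarrow> lam * (L / 2 * (w * (1 / 2) ^ (?d - 1)))) (at_left (1 / 2))"
    by (intro tendsto_intros)
  moreover have "7 < lam * (L / 2 * (w * (1 / 2) ^ (?d - 1)))"
  proof -
    have pow: "1 / 2 ^ ?d = (1 / 2 :: real) ^ (?d - 1) * (1 / 2)"
      by (subst power_minus_mult) (simp_all add: power_one_over)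
    have "lam * (L / 2 * (w * (1 / 2) ^ (?d - 1))) = lam * L * w * (1 / 2 ^ ?d)"
      unfolding pow by simp
    also have "\<dots> = 4 * (w * Gamma ((real ?d + 1) / 2)) / pi powr (real ?d / 2 - 1)"
    proof -
      have "4 * (c * g / P) * inverse L * L * w * (1 / c) = 4 * (w * g) / P" if "c \<noteq> 0" for c g P
        using that L by (simp add: field_simps)
      then show ?thesis unfolding lam_def by this simp_all
    qed
    also have "\<dots> = 4 * pi powr (1 / 2)"
    proof -
      have "(real ?d - 1) / 2 - (real ?d / 2 - 1) = 1 / 2" by (simp add: field_simps)
      then have "pi powr ((real ?d - 1) / 2) / pi powr (real ?d / 2 - 1) = pi powr (1 / 2)"
        by (simp only: powr_diff[symmetric])
      then show ?thesis unfolding w_Gamma by (simp only: times_divide_eq_right[symmetric])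
    qed
    also have "\<dots> = 4 * sqrt pi" by (simp add: powr_half_sqrt)
    also have "\<dots> > 7"
    proof -
      have "(7 / 4)\<^sup>2 < pi" using pi_approx by (simp add: power2_eq_square)
      then have "7 / 4 < sqrt pi" by (rule real_less_rsqrt)
      then show ?thesis by simp
    qed
    finally show ?thesis .
  qed
  ultimately have "eventually (\<lambda>r. 7 < lam * (L / 2 * (w * r ^ (?d - 1)))) (at_left (1 / 2))"
    by (rule order_tendstoD(1))
  moreover have "eventually (\<lambda>r::real. r \<in> {0<..<1 / 2}) (at_left (1 / 2))"
    by (rule eventually_at_left_real) simp
  ultimately have "eventually (\<lambda>r. 7 < lam * (L / 2 * (w * r ^ (?d - 1))) \<and> r \<in> {0<..<1 / 2}) (at_left (1 / 2))"
    by (rule eventually_conj)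
  then obtain r where r: "0 < r" "r < 1 / 2" "7 < lam * (L / 2 * (w * r ^ (?d - 1)))"
    using eventually_happens[of _ "at_left (1 / 2 :: real)"] by auto
  have "AE \<omega> in M lam. percolates (stick_union L (X lam \<omega>))"
    using AE_unbounded_connected[OF e f L r(1,2) less_imp_le[OF r(3)[unfolded w_def]]]
  proof eventually_elim
    case (elim \<omega>)
    then obtain U where U: "connected U" "\<not> bounded U"
      "U \<subseteq> (\<Union>x\<in>{x. (x, e) \<in> X lam \<omega>}. stick L (x, e))" by blast
    from U(3) have "U \<subseteq> stick_union L (X lam \<omega>)" unfolding stick_union_def by blast
    with U(1,2) show ?case by (rule percolates_mono_connected)
  qed
  with lam show "lam > 0" "AE \<omega> in M lam. percolates (stick_union L (X lam \<omega>))" by auto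
qed

end

theorem theorem3p2:
  fixes coord :: "nat \<Rightarrow> 'n::finite"
    and M :: "real \<Rightarrow> 'w measure"
    and X :: "real \<Rightarrow> 'w \<Rightarrow> ((real ^ 'n) \<times> (real ^ 'n)) set"
    and d :: nat
  assumes d: "d = CARD('n)" "d \<ge> 2"
    and coord: "bij_betw coord {1..d} UNIV"
    and rigid: "poisson_stick_model (rigid_orientation (axis (coord 2) 1)) M X"
  shows "(\<forall>L>3. critical_intensity M X L \<ge>
            ereal (Gamma ((real d + 1) / 2) / (2 ^ d * pi powr (real d / 2)) * inverse L))
       \<and> (\<forall>L>10. critical_intensity M X L \<le>
            ereal (4 * (2 ^ d * Gamma ((real d + 1) / 2) / pi powr (real d / 2 - 1)) * inverse L))"
proof -
  have e: "axis (coord 2) 1 \<in> (Basis :: (real ^ 'n) set)"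
    by simp
  have D: "DIM(real ^ 'n) = d" using d by simp
  have "DIM(real ^ 'n) \<ge> 2" using d D by simp
  note ge = critical_intensity_ge[OF e this rigid, unfolded D]
    and le = critical_intensity_le[OF e this rigid, unfolded D]
  show ?thesis
  proof (intro conjI allI impI)
    fix L :: real assume "L > 10"
    then have "L > 0" by simp
    then show "critical_intensity M X L \<le>
        ereal (4 * (2 ^ d * Gamma ((real d + 1) / 2) / pi powr (real d / 2 - 1)) * inverse L)"
      by (rule le)
  qed (rule ge)
qed

end
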